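(* For every integer $n\ge 4$ there is an element of order $n-2$ in the outer automorphism group $\mathrm{Out}(B_n(\mathbf{R}))$.
   Context: Functions are written to the right of their arguments and composed from left to right. For an integer $n\ge 2$: $\mathbf{Z}[\frac1n]=\{an^b : a,b\in\mathbf{Z}\}$ and $\langle n\rangle=\{n^k : k\in\mathbf{Z}\}$. A break of a piecewise linear (PL) function is a point where its derivative is discontinuous. $A_n(\mathbf{R})$ is the group of all homeomorphisms $h:\mathbf{R}\to\mathbf{R}$ such that (1) $h$ preserves orientation, (2) $h$ is PL, (3) all slopes of $h$ are in $\langle n\rangle$, (4) the breaks of $h$ lie in a discrete subset of $\mathbf{Z}[\frac1n]$, (5) $(\mathbf{Z}[\frac1n])h=\mathbf{Z}[\frac1n]$. Let $\phi_n:\mathbf{Z}[\frac1n]\to\mathbf{Z}_{n-1}=\mathbf{Z}/(n-1)\mathbf{Z}$ be the well-defined surjective ring homomorphism $(an^b)\phi_n=a\pmod{n-1}$. There is a well-defined homomorphism $\rho_n:A_n(\mathbf{R})\to\mathbf{Z}_{n-1}$, $f\rho_n=(xf)\phi_n-x\phi_n$ for any $x\in\mathbf{Z}[\frac1n]$, and $B_n(\mathbf{R})=\ker\rho_n$. *)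

theory Defs
  imports "HOL-Analysis.Analysis" "HOL-Algebra.Algebra"
begin

definition n_adic :: "nat \<Rightarrow> real set" where
  "n_adic n = {of_int a * real n powi b |a b :: int. True}"

definition n_powers :: "nat \<Rightarrow> real set" where
  "n_powers n = range (\<lambda>k::int. real n powi k)"

text \<open>Sparseness in \<^term>\<open>UNIV\<close> means that there is no accumulation point in the line, that is,
  discreteness in the locally finite sense. This is the usual meaning for PL maps of the line; mere
  relative discreteness would not be preserved by composition.\<close>

definition piecewise_linear :: "(real \<Rightarrow> real) \<Rightarrow> bool" where
  "piecewise_linear f \<longleftrightarrow> continuous_on UNIV f \<and>
     (\<exists>S. S sparse_in UNIV \<and>
        (\<forall>a b. a < b \<longrightarrow> {a<..<b} \<inter> S = {} \<longrightarrow>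
           (\<exists>m c. \<forall>x\<in>{a<..<b}. f x = m * x + c)))"

text \<open>Where \<^term>\<open>f\<close> is not differentiable, \<^term>\<open>deriv f x\<close> is an unspecified number. For piecewise
  linear \<^term>\<open>f\<close> this is harmless: at a corner the one-sided limits of the derivative differ, so no
  value there makes it continuous.\<close>

definition breaks :: "(real \<Rightarrow> real) \<Rightarrow> real set" where
  "breaks f = {x. \<not> isCont (deriv f) x}"

definition A_set :: "nat \<Rightarrow> (real \<Rightarrow> real) set" where
  "A_set n = {h. (\<exists>g. homeomorphism UNIV UNIV h g)
     \<and> strict_mono h
     \<and> piecewise_linear h
     \<and> (\<forall>x m. (h has_real_derivative m) (at x) \<longrightarrow> m \<in> n_powers n)
     \<and> (\<exists>D. D \<subseteq> n_adic n \<and> D sparse_in UNIV \<and> breaks h \<subseteq> D)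
     \<and> h ` n_adic n = n_adic n}"

text \<open>Maps are composed from left to right.\<close>

definition A_group :: "nat \<Rightarrow> (real \<Rightarrow> real) monoid" where
  "A_group n = \<lparr>carrier = A_set n, monoid.mult = (\<lambda>f g. g \<circ> f), one = id\<rparr>"

text \<open>Residue classes modulo \<open>n - 1\<close> are represented by the integers in \<open>{0..<n - 1}\<close>, the
  carrier of \<^term>\<open>integer_mod_group (n - 1)\<close>.\<close>

definition \<phi> :: "nat \<Rightarrow> real \<Rightarrow> int" where
  "\<phi> n x = (THE r. \<exists>a b :: int. x = of_int a * real n powi b \<and> r = a mod (int n - 1))"

lemma \<phi>_well_defined:
  fixes a b a' b' :: int
  assumes n: "n \<ge> 2" and eq: "of_int a * real n powi b = of_int a' * real n powi b'"
  shows "a mod (int n - 1) = a' mod (int n - 1)"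
proof -
  define m where "m = min b b'"
  define k where "k = nat (b - m)"
  define k' where "k' = nat (b' - m)"
  have b: "b = m + int k" "b' = m + int k'"
    by (auto simp: m_def k_def k'_def)
  have "(of_int a * real n ^ k) * real n powi m = (of_int a' * real n ^ k') * real n powi m"
  proof -
    have "real n powi b = real n ^ k * real n powi m"
      using n by (simp add: b(1) power_int_add)
    moreover have "real n powi b' = real n ^ k' * real n powi m"
      using n by (simp add: b(2) power_int_add)
    ultimately show ?thesis using eq by (simp only: mult.assoc)
  qed
  hence "of_int a * real n ^ k = of_int a' * real n ^ k'"
    using n by simp
  hence "of_int (a * int n ^ k) = (of_int (a' * int n ^ k') :: real)"
    by simp
  hence e: "a * int n ^ k = a' * int n ^ k'"
    by (simp only: of_int_eq_iff)
  have pow: "c * int n ^ j mod (int n - 1) = c mod (int n - 1)" for c j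
  proof -
    have "int n mod (int n - 1) = 1 mod (int n - 1)"
      by (simp add: mod_eq_dvd_iff)
    hence "int n ^ j mod (int n - 1) = 1 ^ j mod (int n - 1)"
      using power_mod[of "int n" "int n - 1" j] power_mod[of 1 "int n - 1" j] by (simp only:)
    thus ?thesis
      using mod_mult_right_eq[of c "int n ^ j" "int n - 1"] mod_mult_right_eq[of c 1 "int n - 1"]
      by (simp only: power_one mult_1_right)
  qed
  show ?thesis
    using pow[of a k] pow[of a' k'] e by (simp only:)
qed

lemma \<phi>_eq: "n \<ge> 2 \<Longrightarrow> \<phi> n (of_int a * real n powi b) = a mod (int n - 1)"
  unfolding \<phi>_def by (rule the_equality) (blast, metis \<phi>_well_defined)

definition \<rho> :: "nat \<Rightarrow> (real \<Rightarrow> real) \<Rightarrow> int" where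
  "\<rho> n f = (THE r. \<forall>x\<in>n_adic n. r = (\<phi> n (f x) - \<phi> n x) mod (int n - 1))"

definition B_group :: "nat \<Rightarrow> (real \<Rightarrow> real) monoid" where
  "B_group n = A_group n \<lparr>carrier := kernel (A_group n) (integer_mod_group (n - 1)) (\<rho> n)\<rparr>"

definition Inn :: "('a, 'b) monoid_scheme \<Rightarrow> ('a \<Rightarrow> 'a) set" where
  "Inn G = {\<lambda>x\<in>carrier G. inv\<^bsub>G\<^esub> g \<otimes>\<^bsub>G\<^esub> x \<otimes>\<^bsub>G\<^esub> g |g. g \<in> carrier G}"

definition Out :: "('a, 'b) monoid_scheme \<Rightarrow> ('a \<Rightarrow> 'a) set monoid" where
  "Out G = AutoGroup G Mod Inn G"

end

theory Submission
  imports Defs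
begin

text \<open>
  The group acts on \<open>Z[1/n]\<close> with the residue classes modulo \<open>n - 1\<close> as orbits. Translations
  permute all these classes cyclically. The automorphism constructed here fixes the class \<open>0\<close> and
  permutes the other \<open>n - 2\<close> classes cyclically; it is conjugation by a homeomorphism of the line
  that need not be piecewise linear.

  The idea is a self-similar subdivision of the line that treats the nonzero classes alike. Put
  \<open>M = n - 2\<close> and read the index \<open>i\<close> modulo \<open>M\<close>, so that \<open>i + 1\<close> runs through the nonzero
  classes and class \<open>M\<close> is followed by class \<open>1\<close>. A cell is an interval with n-adic ends, labelled by
  the classes of its ends: \<open>Lft i\<close> runs from \<open>0\<close> to \<open>i + 1\<close>, \<open>Rgt i\<close> from \<open>i + 1\<close> to \<open>0\<close>, and \<open>Mid i\<close>
  from \<open>i + 1\<close> to the class after it. Cells are cut in two by the rules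
  \<open>Lft i = Lft (i - 1) Mid (i - 1)\<close>, \<open>Rgt i = Mid i Rgt (i + 1)\<close> and \<open>Mid i = Rgt i Lft (i + 1)\<close>,
  which are invariant under \<open>i \<mapsto> i + 1\<close>. Iterating these binary cuts produces the usual subdivision
  into \<open>n\<close> equal parts: every interval from \<open>a n^e\<close> to \<open>(a + 1) n^e\<close> is a cell (\<open>unit_cell_all\<close>), and
  its label is determined by the class of \<open>a\<close> (\<open>label_unique\<close>). Therefore a homeomorphism belongs to
  the group if and only if, on either side of every point, it maps some cell affinely onto a cell with
  the same label (\<open>carrier_B_group\<close>, \<open>ideal_germs_eq_normalising\<close>).

  This description only involves the labelled binary tree. Cutting at midpoints instead gives a second
  model of the tree, the dyadic intervals, and an increasing homeomorphism \<open>\<Psi>\<close> from the dyadic to the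
  n-adic model. In the dyadic model the map \<open>dilate\<close>, which is \<open>2 x\<close> on the right and \<open>x / 2\<close> on the
  left of \<open>0\<close>, maps every cell to a cell whose index is larger by one. Hence it normalises the
  group, and its \<open>k\<close>-th power belongs to the group if and only if \<open>M\<close> divides \<open>k\<close>
  (\<open>dilate_power\<close>, \<open>shifting_cong\<close>, \<open>shifting_disjoint\<close>). Only the identity commutes with the whole
  group (\<open>centraliser_trivial\<close>), so the same condition decides whether conjugation by the \<open>k\<close>-th power
  is an inner automorphism, and the outer class of conjugation by \<open>dilate\<close> has order \<open>M = n - 2\<close>.
\<close>

section \<open>Outer automorphisms of prescribed order\<close>

lemma AutoGroup_simps:
  "carrier (AutoGroup G) = auto G"
  "\<one>\<^bsub>AutoGroup G\<^esub> = (\<lambda>x\<in>carrier G. x)"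
  "f \<in> auto G \<Longrightarrow> g \<in> auto G \<Longrightarrow> f \<otimes>\<^bsub>AutoGroup G\<^esub> g = (\<lambda>x\<in>carrier G. f (g x))"
  by (auto simp: AutoGroup_def BijGroup_def auto_def compose_def)

lemma autoI:
  assumes "\<alpha> \<in> extensional (carrier G)"
    and "\<And>x. x \<in> carrier G \<Longrightarrow> \<alpha> x \<in> carrier G"
    and "\<And>x. x \<in> carrier G \<Longrightarrow> \<beta> x \<in> carrier G"
    and "\<And>x. x \<in> carrier G \<Longrightarrow> \<alpha> (\<beta> x) = x" "\<And>x. x \<in> carrier G \<Longrightarrow> \<beta> (\<alpha> x) = x"
    and "\<And>x y. x \<in> carrier G \<Longrightarrow> y \<in> carrier G \<Longrightarrow> \<alpha> (x \<otimes>\<^bsub>G\<^esub> y) = \<alpha> x \<otimes>\<^bsub>G\<^esub> \<alpha> y"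
  shows "\<alpha> \<in> auto G"
proof -
  have "bij_betw \<alpha> (carrier G) (carrier G)"
    by (rule bij_betw_byWitness[where f' = \<beta>]) (use assms in auto)
  then show ?thesis using assms by (auto simp: auto_def Bij_def hom_def)
qed

context group
begin

definition inner_aut :: "'a \<Rightarrow> 'a \<Rightarrow> 'a" where
  "inner_aut g = (\<lambda>x\<in>carrier G. inv g \<otimes> x \<otimes> g)"

lemma Inn_eq: "Inn G = inner_aut ` carrier G"
  by (auto simp: Inn_def inner_aut_def)

lemma inner_aut_closed: "g \<in> carrier G \<Longrightarrow> x \<in> carrier G \<Longrightarrow> inner_aut g x \<in> carrier G"
  by (simp add: inner_aut_def)

lemma inner_aut_comp:
  assumes "g \<in> carrier G" "h \<in> carrier G" "x \<in> carrier G"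
  shows "inner_aut g (inner_aut h x) = inner_aut (h \<otimes> g) x"
  using assms by (simp add: inner_aut_def inv_mult_group m_assoc)

lemma inner_aut_in_auto:
  assumes g: "g \<in> carrier G"
  shows "inner_aut g \<in> auto G"
proof (rule autoI[where \<beta> = "inner_aut (inv g)"])
  show "inner_aut g (x \<otimes> y) = inner_aut g x \<otimes> inner_aut g y"
    if "x \<in> carrier G" "y \<in> carrier G" for x y
    using that g by (simp add: inner_aut_def m_assoc) (metis inv_closed inv_solve_left m_assoc m_closed r_inv r_one l_one)
qed (use g in \<open>auto simp: inner_aut_comp inner_aut_closed\<close>, auto simp: inner_aut_def)

lemma auto_inner_aut:
  assumes "\<alpha> \<in> auto G" "g \<in> carrier G" "x \<in> carrier G"
  shows "\<alpha> (inner_aut g x) = inner_aut (\<alpha> g) (\<alpha> x)"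
proof -
  have "\<alpha> \<in> hom G G" using assms by (simp add: auto_def)
  then interpret group_hom G G \<alpha> by unfold_locales
  show ?thesis using assms by (simp add: inner_aut_def)
qed

lemma Inn_normal: "Inn G \<lhd> AutoGroup G"
proof -
  interpret A: group "AutoGroup G" by (rule AutoGroup)
  have mult: "inner_aut g \<otimes>\<^bsub>AutoGroup G\<^esub> inner_aut h = inner_aut (h \<otimes> g)"
    if "g \<in> carrier G" "h \<in> carrier G" for g h
    using that by (auto simp: AutoGroup_simps inner_aut_in_auto inner_aut_comp fun_eq_iff)
      (auto simp: inner_aut_def)
  have one: "inner_aut \<one> = \<one>\<^bsub>AutoGroup G\<^esub>"
    by (auto simp: AutoGroup_simps inner_aut_def fun_eq_iff)
  have inv: "inv\<^bsub>AutoGroup G\<^esub> inner_aut g = inner_aut (inv g)" if "g \<in> carrier G" for g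
    using that by (intro A.inv_equality) (auto simp: mult one AutoGroup_simps(1) inner_aut_in_auto)
  have "subgroup (Inn G) (AutoGroup G)"
    by (rule A.subgroupI) (auto simp: Inn_eq AutoGroup_simps(1) inner_aut_in_auto inv mult)
  moreover have "\<alpha> \<otimes>\<^bsub>AutoGroup G\<^esub> h \<otimes>\<^bsub>AutoGroup G\<^esub> inv\<^bsub>AutoGroup G\<^esub> \<alpha> \<in> Inn G"
    if a: "\<alpha> \<in> carrier (AutoGroup G)" and h: "h \<in> Inn G" for \<alpha> h
  proof -
    have a': "\<alpha> \<in> auto G" using a by (simp add: AutoGroup_simps)
    have cl: "\<alpha> x \<in> carrier G" if "x \<in> carrier G" for x
      using a' that by (auto simp: auto_def hom_def)
    obtain g where g: "g \<in> carrier G" "h = inner_aut g" using h by (auto simp: Inn_eq)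
    have "(\<lambda>x\<in>carrier G. \<alpha> (inner_aut g x)) = (\<lambda>x\<in>carrier G. inner_aut (\<alpha> g) (\<alpha> x))"
      using g(1) a' by (intro restrict_ext) (rule auto_inner_aut)
    then have "\<alpha> \<otimes>\<^bsub>AutoGroup G\<^esub> h = inner_aut (\<alpha> g) \<otimes>\<^bsub>AutoGroup G\<^esub> \<alpha>"
      unfolding g(2) AutoGroup_simps(3)[OF a' inner_aut_in_auto[OF g(1)]]
        AutoGroup_simps(3)[OF inner_aut_in_auto[OF cl[OF g(1)]] a'] .
    then have "\<alpha> \<otimes>\<^bsub>AutoGroup G\<^esub> h \<otimes>\<^bsub>AutoGroup G\<^esub> inv\<^bsub>AutoGroup G\<^esub> \<alpha> = inner_aut (\<alpha> g)"
      using a A.m_assoc[of "inner_aut (\<alpha> g)" \<alpha> "inv\<^bsub>AutoGroup G\<^esub> \<alpha>"] A.r_inv[of \<alpha>]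
        inner_aut_in_auto[OF cl[OF g(1)]] A.inv_closed[of \<alpha>] A.r_one[of "inner_aut (\<alpha> g)"]
      by (simp only: AutoGroup_simps(1))
    then show ?thesis using g cl by (auto simp: Inn_eq)
  qed
  ultimately show ?thesis using A.normal_inv_iff by blast
qed

text \<open>A power of the coset of \<open>\<alpha>\<close> is trivial exactly when the same power of \<open>\<alpha>\<close> is inner, so the order
  of the coset can be read off from the powers of \<open>\<alpha>\<close>.\<close>

lemma ex_Out_of_order:
  assumes \<alpha>: "\<alpha> \<in> auto G"
    and *: "\<And>k::nat. \<alpha> [^]\<^bsub>AutoGroup G\<^esub> k \<in> Inn G \<longleftrightarrow> d dvd k"
  shows "\<exists>x\<in>carrier (Out G). group.ord (Out G) x = d"
proof -
  interpret A: group "AutoGroup G" by (rule AutoGroup)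
  interpret N: normal "Inn G" "AutoGroup G" by (rule Inn_normal)
  interpret O: group "Out G" unfolding Out_def by (rule N.factorgroup_is_group)
  define x where "x = Inn G #>\<^bsub>AutoGroup G\<^esub> \<alpha>"
  have ac: "\<alpha> \<in> carrier (AutoGroup G)" using \<alpha> by (simp add: AutoGroup_simps)
  have x: "x \<in> carrier (Out G)" using ac by (auto simp: x_def Out_def carrier_FactGroup)
  have "x [^]\<^bsub>Out G\<^esub> k = \<one>\<^bsub>Out G\<^esub> \<longleftrightarrow> d dvd k" for k :: nat
  proof -
    have "x [^]\<^bsub>Out G\<^esub> k = Inn G #>\<^bsub>AutoGroup G\<^esub> (\<alpha> [^]\<^bsub>AutoGroup G\<^esub> k)"
      unfolding x_def Out_def by (rule N.FactGroup_pow[OF ac])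
    moreover have "Inn G #>\<^bsub>AutoGroup G\<^esub> a = Inn G \<longleftrightarrow> a \<in> Inn G" if "a \<in> carrier (AutoGroup G)" for a
      using that A.coset_join1 A.coset_join2 N.subgroup_axioms by blast
    ultimately show ?thesis using ac * by (simp add: Out_def)
  qed
  then show ?thesis using x O.ord_unique by blast
qed

end

section \<open>The n-adic rationals modulo n - 1\<close>

text \<open>The kernel of \<open>\<phi>\<close>, as \<open>\<phi>_eq_iff\<close> shows. Congruences in this ideal replace computations with
  residues, because they are compatible with real arithmetic.\<close>

definition nadic_ideal :: "nat \<Rightarrow> real set" where
  "nadic_ideal n = (\<lambda>x. (real n - 1) * x) ` n_adic n"

context
  fixes n :: nat
  assumes n2: "n \<ge> 2"
begin

lemma n_adicI: "of_int a * real n powi b \<in> n_adic n"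
  by (auto simp: n_adic_def)

text \<open>All sufficiently fine n-adic grids contain a given n-adic number; this yields common denominators.\<close>

lemma n_adic_expand:
  assumes "x \<in> n_adic n"
  shows "\<exists>k0. \<forall>k\<ge>k0. \<exists>a. x = of_int a * real n powi (- k)"
proof -
  obtain a b where x: "x = of_int a * real n powi b" using assms by (auto simp: n_adic_def)
  show ?thesis
  proof (rule exI[of _ "- b"], intro allI impI)
    fix k assume "- b \<le> k"
    then have "real n powi b = real n ^ nat (b + k) * real n powi (- k)"
      using n2 by (simp flip: power_int_of_nat add: power_int_add[symmetric])
    then show "\<exists>a. x = of_int a * real n powi (- k)"
      by (intro exI[of _ "a * int n ^ nat (b + k)"]) (simp add: x)
  qed
qed

lemma n_adic_common:
  assumes "x \<in> n_adic n" "y \<in> n_adic n"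
  obtains a b k where "x = of_int a * real n powi k" "y = of_int b * real n powi k"
proof -
  obtain k1 k2 where "\<forall>k\<ge>k1. \<exists>a. x = of_int a * real n powi (- k)"
    "\<forall>k\<ge>k2. \<exists>a. y = of_int a * real n powi (- k)"
    using n_adic_expand assms by meson
  then have "\<exists>a. x = of_int a * real n powi (- max k1 k2)" "\<exists>a. y = of_int a * real n powi (- max k1 k2)"
    by auto
  then show ?thesis using that by blast
qed

lemma n_adic_powi [simp]: "real n powi k \<in> n_adic n"
  using n_adicI[of 1] by simp

lemma n_adic_of_int [simp]: "of_int a \<in> n_adic n"
  using n_adicI[of a 0] by simp

lemma n_adic_add [intro]: "x \<in> n_adic n \<Longrightarrow> y \<in> n_adic n \<Longrightarrow> x + y \<in> n_adic n"
  by (erule (1) n_adic_common) (metis distrib_right n_adicI of_int_add)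

lemma n_adic_mult [intro]:
  assumes "x \<in> n_adic n" "y \<in> n_adic n" shows "x * y \<in> n_adic n"
proof -
  obtain a b k where "x = of_int a * real n powi k" "y = of_int b * real n powi k"
    using assms by (rule n_adic_common)
  then have "x * y = of_int (a * b) * real n powi (k + k)"
    using n2 power_int_add[of "real n" k k] by simp
  then show ?thesis using n_adicI by metis
qed

lemma n_adic_uminus [intro]: "x \<in> n_adic n \<Longrightarrow> - x \<in> n_adic n"
  using n_adic_mult[OF n_adic_of_int[of "-1"]] by simp

lemma n_adic_diff [intro]: "x \<in> n_adic n \<Longrightarrow> y \<in> n_adic n \<Longrightarrow> x - y \<in> n_adic n"
  using n_adic_add[OF _ n_adic_uminus] by (metis diff_conv_add_uminus)

lemma n_adic_dense:
  assumes "x < y" shows "\<exists>z\<in>n_adic n. x < z \<and> z < y"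
proof -
  obtain k where k: "1 / (y - x) < real n ^ k"
    using real_arch_pow[of "real n"] n2 by auto
  define p where "p = real n ^ k"
  have p: "p > 0" "1 < (y - x) * p" using k n2 assms by (auto simp: p_def field_simps)
  define a where "a = \<lfloor>x * p\<rfloor> + 1"
  have "x * p < of_int a" "of_int a \<le> x * p + 1" unfolding a_def by linarith+
  then have "x < of_int a / p" "of_int a / p < y"
    using p by (auto simp: field_simps)
  moreover have "of_int a / p \<in> n_adic n"
    using n_adicI[of a "- int k"] by (simp add: p_def power_int_minus divide_inverse)
  ultimately show ?thesis by blast
qed

lemma ideal_n_adic: "x \<in> nadic_ideal n \<Longrightarrow> x \<in> n_adic n"
  unfolding nadic_ideal_def using n_adic_mult[OF n_adic_of_int[of "int n - 1"]] n2
  by (auto simp: of_nat_diff)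

lemma ideal_add [intro]: "x \<in> nadic_ideal n \<Longrightarrow> y \<in> nadic_ideal n \<Longrightarrow> x + y \<in> nadic_ideal n"
  by (auto simp: nadic_ideal_def distrib_left[symmetric])

lemma ideal_mult [intro]: "x \<in> n_adic n \<Longrightarrow> y \<in> nadic_ideal n \<Longrightarrow> x * y \<in> nadic_ideal n"
  by (auto simp: nadic_ideal_def mult.left_commute)

lemma ideal_uminus [intro]: "y \<in> nadic_ideal n \<Longrightarrow> - y \<in> nadic_ideal n"
  using ideal_mult[OF n_adic_of_int[of "-1"]] by simp

lemma ideal_diff [intro]: "x \<in> nadic_ideal n \<Longrightarrow> y \<in> nadic_ideal n \<Longrightarrow> x - y \<in> nadic_ideal n"
  using ideal_add[OF _ ideal_uminus] by (metis diff_conv_add_uminus)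

lemma ideal_zero [simp]: "0 \<in> nadic_ideal n"
  using n_adic_of_int[of 0] by (auto simp: nadic_ideal_def intro!: image_eqI[of _ _ 0])

lemma ideal_nat_power: "real n ^ k - 1 \<in> nadic_ideal n"
proof -
  have "real n ^ k - 1 = (real n - 1) * of_int (\<Sum>i<k. int n ^ i)"
    using power_diff_1_eq[of "real n" k] by simp
  then show ?thesis by (auto simp: nadic_ideal_def simp del: of_int_sum)
qed

text \<open>Since \<open>n\<close> is \<open>1\<close> modulo \<open>n - 1\<close>, slopes do not affect residue classes: an affine map with such a
  slope changes the class of every n-adic number by the class of its constant term.\<close>

lemma ideal_powi: "real n powi k - 1 \<in> nadic_ideal n"
proof (cases "k \<ge> 0")
  case True
  then show ?thesis using ideal_nat_power[of "nat k"] by (simp flip: power_int_of_nat)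
next
  case False
  have "real n powi k - 1 = - (real n powi k * (real n ^ nat (- k) - 1))"
    using False n2 by (simp add: algebra_simps flip: power_int_of_nat) (simp add: power_int_add[symmetric] flip: power_int_minus)
  then show ?thesis by (metis ideal_mult ideal_nat_power ideal_uminus n_adic_powi)
qed

lemma ideal_slope: "x \<in> n_adic n \<Longrightarrow> real n powi k * x - x \<in> nadic_ideal n"
  using ideal_mult[OF _ ideal_powi, of x k] by (simp add: algebra_simps)

lemma ideal_of_int: "of_int a \<in> nadic_ideal n \<longleftrightarrow> (int n - 1) dvd a"
proof
  assume "of_int a \<in> nadic_ideal n"
  then obtain c b where "of_int a = (real n - 1) * (of_int c * real n powi b)"
    by (auto simp: nadic_ideal_def n_adic_def)
  then have "of_int a * real n powi 0 = of_int ((int n - 1) * c) * real n powi b" by simp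
  from \<phi>_well_defined[OF n2 this] show "(int n - 1) dvd a" by (simp add: dvd_eq_mod_eq_0)
next
  assume "(int n - 1) dvd a"
  then obtain c where "a = (int n - 1) * c" by blast
  then have "of_int a = (real n - 1) * of_int c" by simp
  then show "of_int a \<in> nadic_ideal n" by (auto simp: nadic_ideal_def)
qed

lemma \<phi>_eq_iff:
  assumes "x \<in> n_adic n" "y \<in> n_adic n"
  shows "\<phi> n x = \<phi> n y \<longleftrightarrow> x - y \<in> nadic_ideal n"
proof -
  obtain a b k where xy: "x = of_int a * real n powi k" "y = of_int b * real n powi k"
    using assms by (rule n_adic_common)
  have "\<phi> n x = \<phi> n y \<longleftrightarrow> (int n - 1) dvd (a - b)"
    by (simp add: xy \<phi>_eq[OF n2] mod_eq_dvd_iff)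
  also have "\<dots> \<longleftrightarrow> of_int (a - b) \<in> nadic_ideal n" by (simp only: ideal_of_int)
  also have "\<dots> \<longleftrightarrow> x - y \<in> nadic_ideal n"
  proof
    assume "of_int (a - b) \<in> nadic_ideal n"
    from ideal_mult[OF n_adic_powi[of k] this]
    show "x - y \<in> nadic_ideal n" by (simp add: xy algebra_simps)
  next
    assume "x - y \<in> nadic_ideal n"
    from ideal_mult[OF n_adic_powi[of "- k"] this] n2
    show "of_int (a - b) \<in> nadic_ideal n"
      by (simp add: xy algebra_simps power_int_minus)
  qed
  finally show ?thesis .
qed

end

section \<open>A labelled binary subdivision of the line\<close>

text \<open>The kind of a cell records which of its ends has class \<open>0\<close>: the left one, the right one or none.
  The second component of a label is an index modulo \<open>n - 2\<close> that determines the classes of the other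
  ends.\<close>

datatype kind = Lft | Rgt | Mid

type_synonym label = "kind \<times> int"

locale subdivision =
  fixes n :: nat
  assumes n_ge_4: "n \<ge> 4"
begin

definition M :: int where "M = int n - 2"

lemma M_ge_2: "M \<ge> 2" using n_ge_4 by (simp add: M_def)

lemma int_n: "int n = M + 2" by (simp add: M_def)

lemma n_ge_2: "n \<ge> 2" using n_ge_4 by simp

fun lower :: "label \<Rightarrow> label" where
  "lower (Lft, i) = (Lft, (i - 1) mod M)"
| "lower (Rgt, i) = (Mid, i)"
| "lower (Mid, i) = (Rgt, i)"

fun upper :: "label \<Rightarrow> label" where
  "upper (Lft, i) = (Mid, (i - 1) mod M)"
| "upper (Rgt, i) = (Rgt, (i + 1) mod M)"
| "upper (Mid, i) = (Lft, (i + 1) mod M)"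

text \<open>The length of a cell in units of a power of \<open>n\<close>. Modulo \<open>n - 1\<close> it is the difference of the classes
  of the ends, and it is the least positive such number.\<close>

fun width :: "label \<Rightarrow> int" where
  "width (Lft, i) = i + 1"
| "width (Rgt, i) = M - i"
| "width (Mid, i) = (if i = M - 1 then 2 else 1)"

text \<open>The class of the left end of a cell.\<close>

fun start :: "label \<Rightarrow> int" where
  "start (Lft, i) = 0"
| "start (Rgt, i) = i + 1"
| "start (Mid, i) = i + 1"

text \<open>The symmetry of the subdivision: it moves the nonzero classes cyclically and keeps the class \<open>0\<close>.\<close>

definition rot :: "int \<Rightarrow> label \<Rightarrow> label" where
  "rot k s = (fst s, (snd s + k) mod M)"

definition valid :: "label \<Rightarrow> bool" where
  "valid s \<longleftrightarrow> snd s \<in> {0..<M}"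

lemma lower_upper_rot: "lower (rot k s) = rot k (lower s)" "upper (rot k s) = rot k (upper s)"
  by (cases s rule: lower.cases; simp add: rot_def mod_simps algebra_simps)+

lemma valid_lower_upper: "valid s \<Longrightarrow> valid (lower s)" "valid s \<Longrightarrow> valid (upper s)"
  using M_ge_2 by (cases s rule: lower.cases; simp add: valid_def)+

lemma rot_add: "rot k (rot l s) = rot (k + l) s"
  by (simp add: rot_def mod_simps algebra_simps)

lemma rot_eq_iff:
  assumes "valid s" shows "rot k s = rot l s \<longleftrightarrow> M dvd k - l"
  by (cases s) (auto simp: rot_def mod_eq_dvd_iff)

lemma rot_0: "valid s \<Longrightarrow> rot 0 s = s"
  by (cases s) (auto simp: rot_def valid_def)

lemma width_pos: "valid s \<Longrightarrow> width s \<ge> 1"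
  by (cases s rule: lower.cases) (auto simp: valid_def)

lemma mod_cases:
  assumes "0 \<le> i" "i < M"
  shows "(i + 1) mod M = (if i = M - 1 then 0 else i + 1)" "(i - 1) mod M = (if i = 0 then M - 1 else i - 1)"
  using assms M_ge_2 by (auto simp: zmod_minus1 mod_pos_pos_trivial)

text \<open>Cutting a cell of width at least two does not change the unit. A cell of width one joins two
  consecutive classes, so its interior has to contain a full cycle of classes, which takes \<open>n\<close> smaller
  units.\<close>

lemma width_split:
  assumes "valid s"
  shows "width (lower s) + width (upper s) = (if width s = 1 then int n else width s)"
  using assms M_ge_2 by (cases s rule: lower.cases) (auto simp: valid_def mod_cases int_n)

lemma start_lower: "start (lower s) = start s"
  by (cases s rule: lower.cases) auto

lemma start_upper:
  assumes "valid s"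
  shows "(int n - 1) dvd start (upper s) - (start s + width (lower s))"
proof -
  have "(1 + M) dvd (- 1 - M)"
    by (rule dvdI[of _ _ "-1"]) simp
  then show ?thesis
    using assms M_ge_2 by (cases s rule: lower.cases) (auto simp: valid_def mod_cases int_n)
qed

text \<open>The cells of width one join consecutive classes modulo \<open>n - 1\<close>, and there is one such label for
  each class: \<open>Lft 0\<close> for \<open>0\<close>, \<open>Mid\<close> for the middle classes and \<open>Rgt (M - 1)\<close> for the last one.\<close>

lemma label_unique:
  assumes "valid s" "valid s'" "width s = 1" "width s' = 1" "(int n - 1) dvd start s - start s'"
  shows "s = s'"
proof -
  have "start s \<in> {0..<int n - 1}" if "valid s" for s
    using that M_ge_2 by (cases s rule: lower.cases) (auto simp: valid_def M_def)
  then have "start s = start s'"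
    using assms by (metis atLeastLessThan_iff mod_eq_dvd_iff mod_pos_pos_trivial)
  then show ?thesis using assms
    by (cases s rule: lower.cases; cases s' rule: lower.cases) (auto simp: valid_def split: if_splits)
qed

fun lower_state :: "label \<times> int \<Rightarrow> label \<times> int" where
  "lower_state (s, e) = (lower s, e - (if width s = 1 then 1 else 0))"

fun upper_state :: "label \<times> int \<Rightarrow> label \<times> int" where
  "upper_state (s, e) = (upper s, e - (if width s = 1 then 1 else 0))"

text \<open>The cell with address \<open>(m, j)\<close> corresponds to the dyadic interval from \<open>j / 2^m\<close> to \<open>(j + 1) / 2^m\<close>,
  and \<open>state m j\<close> consists of its label and of the exponent of its unit. The level \<open>m\<close> may be negative,
  so that the tree has no root: the cells on either side of the origin are prescribed at all levels,
  consistently with the cutting rules, and every other cell descends from one of them.\<close>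

function state :: "int \<Rightarrow> int \<Rightarrow> label \<times> int" where
  "state m j =
     (if j = 0 then ((Lft, (- m) mod M), (- m) div M)
      else if j = -1 then ((Rgt, m mod M), - (m div M))
      else if even j then lower_state (state (m - 1) (j div 2))
      else upper_state (state (m - 1) (j div 2)))"
  by auto
termination by (relation "Wellfounded.measure (\<lambda>(m, j). nat \<bar>j\<bar>)") auto

declare state.simps [simp del]

abbreviation lab :: "int \<Rightarrow> int \<Rightarrow> label" where "lab m j \<equiv> fst (state m j)"
abbreviation scale :: "int \<Rightarrow> int \<Rightarrow> int" where "scale m j \<equiv> snd (state m j)"

lemma state_0: "state m 0 = ((Lft, (- m) mod M), (- m) div M)"
  and state_m1: "state m (-1) = ((Rgt, m mod M), - (m div M))"
  by (simp_all add: state.simps)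

lemma div_mod_pred: "(a - 1) div M = a div M - (if a mod M = 0 then 1 else 0)"
    "(a - 1) mod M = (a mod M - 1) mod M"
  and div_mod_succ: "(a + 1) div M = a div M + (if a mod M = M - 1 then 1 else 0)"
proof -
  define q r where "q = a div M" "r = a mod M"
  have a: "a = q * M + r" "0 \<le> r" "r < M" using M_ge_2 by (auto simp: q_r_def)
  show "(a - 1) div M = a div M - (if a mod M = 0 then 1 else 0)"
  proof (cases "r = 0")
    case True
    have "(a - 1) div M = q - 1"
      by (rule int_div_pos_eq[of _ _ _ "M - 1"]) (use a True M_ge_2 in \<open>auto simp: algebra_simps\<close>)
    then show ?thesis using True by (simp add: q_r_def)
  next
    case False
    have "(a - 1) div M = q"
      by (rule int_div_pos_eq[of _ _ _ "r - 1"]) (use a False M_ge_2 in \<open>auto simp: algebra_simps\<close>)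
    then show ?thesis using False by (simp add: q_r_def)
  qed
  show "(a - 1) mod M = (a mod M - 1) mod M" by (simp add: mod_simps)
  show "(a + 1) div M = a div M + (if a mod M = M - 1 then 1 else 0)"
  proof (cases "r = M - 1")
    case True
    have "(a + 1) div M = q + 1"
      by (rule int_div_pos_eq[of _ _ _ 0]) (use a True M_ge_2 in \<open>auto simp: algebra_simps\<close>)
    then show ?thesis using True by (simp add: q_r_def)
  next
    case False
    have "(a + 1) div M = q"
      by (rule int_div_pos_eq[of _ _ _ "r + 1"]) (use a False M_ge_2 in \<open>auto simp: algebra_simps\<close>)
    then show ?thesis using False by (simp add: q_r_def)
  qed
qed

lemma state_even: "state (m + 1) (2 * j) = lower_state (state m j)"
proof (cases "j = 0")
  case True
  then show ?thesis using M_ge_2 div_mod_pred[of "- m"]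
    by (simp add: state_0)
next
  case False
  then show ?thesis by (subst state.simps) auto
qed

lemma state_odd: "state (m + 1) (2 * j + 1) = upper_state (state m j)"
proof (cases "j = -1")
  case True
  then show ?thesis using M_ge_2 div_mod_succ[of m]
    by (auto simp add: state_m1 mod_simps)
next
  case False
  then have "2 * j + 1 \<noteq> 0" "2 * j + 1 \<noteq> - 1" by presburger+
  then show ?thesis by (subst state.simps) auto
qed

lemma lab_even: "lab (m + 1) (2 * j) = lower (lab m j)"
  and lab_odd: "lab (m + 1) (2 * j + 1) = upper (lab m j)"
  by (cases "state m j"; simp add: state_even state_odd)+

lemma scale_child:
  "scale (m + 1) (2 * j) = scale m j - (if width (lab m j) = 1 then 1 else 0)"
  "scale (m + 1) (2 * j + 1) = scale m j - (if width (lab m j) = 1 then 1 else 0)"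
  by (cases "state m j"; simp add: state_even state_odd)+

text \<open>Halving \<open>j\<close> repeatedly ends in \<open>0\<close> or \<open>- 1\<close>, so every cell descends from one at the origin.\<close>

lemma cell_induct [case_names zero minus_one lower upper]:
  fixes m j :: int
  assumes "\<And>m. P m 0" "\<And>m. P m (-1)"
    "\<And>m j. P m j \<Longrightarrow> P (m + 1) (2 * j)" "\<And>m j. P m j \<Longrightarrow> P (m + 1) (2 * j + 1)"
  shows "P m j"
proof (induction m j rule: state.induct)
  case (1 m j)
  show ?case
  proof (cases "j = 0 \<or> j = -1")
    case True then show ?thesis using assms by auto
  next
    case False
    then have "P (m - 1) (j div 2)" using 1 by blast
    then show ?thesis
      using assms(3,4)[of "m - 1" "j div 2"] by (cases "even j") auto
  qed
qed

lemma valid_lab: "valid (lab m j)"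
proof (induction m j rule: cell_induct)
qed (use M_ge_2 in \<open>simp_all add: state_0 state_m1 lab_even lab_odd valid_lower_upper\<close>, auto simp: valid_def)

definition len :: "int \<Rightarrow> int \<Rightarrow> real" where
  "len m j = of_int (width (lab m j)) * real n powi scale m j"

lemma len_pos: "len m j > 0"
  using width_pos[OF valid_lab[of m j]] n_ge_4 by (simp add: len_def)

lemma len_split: "len (m + 1) (2 * j) + len (m + 1) (2 * j + 1) = len m j"
proof -
  have "len (m + 1) (2 * j) + len (m + 1) (2 * j + 1) =
    of_int (width (lower (lab m j)) + width (upper (lab m j))) * real n powi scale (m + 1) (2 * j)"
    by (simp add: len_def lab_even lab_odd scale_child distrib_right)
  also have "\<dots> = len m j"
    using n_ge_4 unfolding width_split[OF valid_lab]
    by (simp add: scale_child len_def power_int_diff)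
  finally show ?thesis .
qed

text \<open>The n-adic position of the left end of a cell. The origin has position \<open>0\<close> at every level, and the
  other positions result from adding up lengths.\<close>

definition pos :: "int \<Rightarrow> int \<Rightarrow> real" where
  "pos m j = (if j \<ge> 0 then \<Sum>i\<in>{0..<j}. len m i else - (\<Sum>i\<in>{j..<0}. len m i))"

lemma pos_0 [simp]: "pos m 0 = 0"
  by (simp add: pos_def)

lemma pos_nonneg: "j \<ge> 0 \<Longrightarrow> pos m j = (\<Sum>i\<in>{0..<j}. len m i)"
  unfolding pos_def by (rule if_P)

lemma pos_nonpos: "j \<le> 0 \<Longrightarrow> pos m j = - (\<Sum>i\<in>{j..<0}. len m i)"
  by (cases "j = 0") (simp_all add: pos_def)

lemma pos_step: "pos m (j + 1) = pos m j + len m j"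
proof (cases "j \<ge> 0")
  case True
  then have *: "{0..<j + 1} = insert j {0..<j}" by auto
  have "(\<Sum>i\<in>{0..<j + 1}. len m i) = len m j + (\<Sum>i\<in>{0..<j}. len m i)"
    unfolding * by (rule sum.insert) (rule finite_atLeastLessThan_int, simp)
  moreover have "pos m (j + 1) = (\<Sum>i\<in>{0..<j + 1}. len m i)"
    by (rule pos_nonneg) (use True in linarith)
  ultimately show ?thesis unfolding pos_nonneg[OF True] by (metis add.commute)
next
  case False
  have *: "{j..<0} = insert j {j + 1..<0}"
  proof (rule Set.set_eqI)
    show "x \<in> {j..<0} \<longleftrightarrow> x \<in> insert j {j + 1..<0}" for x
      unfolding atLeastLessThan_iff insert_iff using False by presburger
  qed
  have "(\<Sum>i\<in>{j..<0}. len m i) = len m j + (\<Sum>i\<in>{j + 1..<0}. len m i)"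
    unfolding * by (rule sum.insert) (rule finite_atLeastLessThan_int, simp)
  moreover have "pos m (j + 1) = - (\<Sum>i\<in>{j + 1..<0}. len m i)"
    by (rule pos_nonpos) (use False in linarith)
  moreover have "pos m j = - (\<Sum>i\<in>{j..<0}. len m i)"
    by (rule pos_nonpos) (use False in linarith)
  ultimately show ?thesis by (metis add.commute add_minus_cancel minus_add_distrib)
qed

lemma pos_refine: "pos (m + 1) (2 * j) = pos m j"
proof (induction j rule: int_induct[of _ 0])
  case (step1 i)
  have e: "2 * (i + 1) = 2 * i + 1 + 1" by simp
  show ?case unfolding e pos_step step1 using len_split[of m i] by linarith
next
  case (step2 i)
  have "pos (m + 1) (2 * i) = pos (m + 1) (2 * (i - 1) + 1 + 1)" by simp
  moreover have "pos m i = pos m (i - 1 + 1)" by simp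
  ultimately show ?case unfolding pos_step using step2 len_split[of m "i - 1"] by linarith
qed simp

lemma pos_refine_pow: "pos (m + int d) (j * 2 ^ d) = pos m j"
proof (induction d)
  case (Suc d)
  then show ?case using pos_refine[of "m + int d" "j * 2 ^ d"] by (simp add: algebra_simps)
qed simp

lemma pos_mono: "i < j \<Longrightarrow> pos m i < pos m j"
proof (induction j rule: int_gr_induct)
  case base then show ?case using pos_step len_pos by simp
next
  case (step j) then show ?case using pos_step[of m j] len_pos[of m j] by simp
qed

lemma pos_less_iff: "pos m i < pos m j \<longleftrightarrow> i < j"
  using pos_mono by (metis linorder_neqE order.asym order.irrefl)

text \<open>The cutting rules commute with the symmetry, so a relation between the labels of two cells is
  inherited by their corresponding descendants.\<close>

lemma lab_shift:
  assumes "lab m' j' = rot k (lab m j)" "0 \<le> i" "i < 2 ^ d"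
  shows "lab (m' + int d) (j' * 2 ^ d + i) = rot k (lab (m + int d) (j * 2 ^ d + i))"
  using assms(2,3)
proof (induction d arbitrary: i)
  case 0
  then have "i = 0" by simp
  then show ?case using assms(1) by simp
next
  case (Suc d)
  have IH: "lab (m' + int d) (j' * 2 ^ d + i div 2) = rot k (lab (m + int d) (j * 2 ^ d + i div 2))"
    using Suc by simp
  have m: "a + int (Suc d) = a + int d + 1" for a by simp
  have "i = 2 * (i div 2) \<or> i = 2 * (i div 2) + 1" by presburger
  then show ?case
  proof
    assume i: "i = 2 * (i div 2)"
    have e: "a * 2 ^ Suc d + i = 2 * (a * 2 ^ d + i div 2)" for a
      by (subst i) simp
    show ?thesis unfolding m e lab_even IH lower_upper_rot ..
  next
    assume i: "i = 2 * (i div 2) + 1"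
    have e: "a * 2 ^ Suc d + i = 2 * (a * 2 ^ d + i div 2) + 1" for a
      by (subst i) simp
    show ?thesis unfolding m e lab_odd IH lower_upper_rot ..
  qed
qed

lemma scale_shift:
  assumes "lab m' j' = lab m j" "0 \<le> i" "i < 2 ^ d"
  shows "scale (m' + int d) (j' * 2 ^ d + i) - scale m' j' = scale (m + int d) (j * 2 ^ d + i) - scale m j"
  using assms(2,3)
proof (induction d arbitrary: i)
  case 0
  then have "i = 0" by simp
  then show ?case by simp
next
  case (Suc d)
  have l: "lab m' j' = rot 0 (lab m j)" using assms(1) by (simp add: rot_0 valid_lab)
  have i2: "0 \<le> i div 2" "i div 2 < 2 ^ d" using Suc by auto
  have IH: "scale (m' + int d) (j' * 2 ^ d + i div 2) - scale m' j' = scale (m + int d) (j * 2 ^ d + i div 2) - scale m j"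
    using Suc.IH i2 by blast
  have L: "lab (m' + int d) (j' * 2 ^ d + i div 2) = lab (m + int d) (j * 2 ^ d + i div 2)"
    using lab_shift[OF l i2] by (simp add: rot_0 valid_lab)
  have "i = 2 * (i div 2) \<or> i = 2 * (i div 2) + 1" by presburger
  then obtain b where b: "b = 0 \<or> b = 1" "i = 2 * (i div 2) + b" by auto
  have "scale (m'' + int (Suc d)) (j'' * 2 ^ Suc d + i) = scale (m'' + int d) (j'' * 2 ^ d + i div 2)
     - (if width (lab (m'' + int d) (j'' * 2 ^ d + i div 2)) = 1 then 1 else 0)" for m'' j''
  proof -
    have e: "j'' * 2 ^ Suc d + i = 2 * (j'' * 2 ^ d + i div 2) + b"
      by (subst b(2)) (simp add: algebra_simps)
    have m: "m'' + int (Suc d) = m'' + int d + 1" by simp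
    show ?thesis unfolding e m using b(1) scale_child[of "m'' + int d" "j'' * 2 ^ d + i div 2"]
      by (elim disjE) (simp_all only: add_0_right)
  qed
  then show ?case using IH L by simp
qed

text \<open>Cells with equal labels are cut in the same proportions, hence their grids of descendants are
  similar.\<close>

lemma pos_self_similar:
  assumes "lab m' j' = lab m j" "i \<le> 2 ^ d"
  shows "pos (m' + int d) (j' * 2 ^ d + int i) - pos m' j'
     = real n powi (scale m' j' - scale m j) * (pos (m + int d) (j * 2 ^ d + int i) - pos m j)"
  using assms(2)
proof (induction i)
  case 0 then show ?case by (simp add: pos_refine_pow)
next
  case (Suc i)
  have l: "lab m' j' = rot 0 (lab m j)" using assms(1) by (simp add: rot_0 valid_lab)
  have i: "0 \<le> int i" "int i < 2 ^ d" using Suc.prems by (auto simp flip: of_nat_less_iff)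
  have "lab (m' + int d) (j' * 2 ^ d + int i) = lab (m + int d) (j * 2 ^ d + int i)"
    using lab_shift[OF l i] by (simp add: rot_0 valid_lab)
  moreover have "scale (m' + int d) (j' * 2 ^ d + int i) =
      (scale m' j' - scale m j) + scale (m + int d) (j * 2 ^ d + int i)"
    using scale_shift[OF assms(1) i] by simp
  ultimately have "len (m' + int d) (j' * 2 ^ d + int i)
      = real n powi (scale m' j' - scale m j) * len (m + int d) (j * 2 ^ d + int i)"
    using n_ge_4 by (simp add: len_def power_int_add)
  then show ?case
    using Suc pos_step[of "m' + int d" "j' * 2 ^ d + int i"] pos_step[of "m + int d" "j * 2 ^ d + int i"]
    by (simp add: algebra_simps)
qed

text \<open>The labels are truthful: the left end of a cell lies in the class that its label announces. Each cut
  preserves this because the units are \<open>1\<close> modulo \<open>n - 1\<close>.\<close>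

lemma pos_start: "pos m j - of_int (start (lab m j)) \<in> nadic_ideal n"
proof (induction m j rule: cell_induct)
  case (zero m)
  then show ?case using ideal_zero[OF n_ge_2] by (simp add: state_0)
next
  case (minus_one m)
  define i q where "i = m mod M" "q = - (m div M)"
  have "pos m (-1) = - len m (-1)" using pos_step[of m "-1"] by simp
  then have "pos m (-1) - of_int (start (lab m (-1))) =
     - (real n powi q * of_int (M - i) - of_int (M - i)) - of_int (int n - 1)"
    by (simp add: state_m1 len_def i_q_def M_def)
  also have "\<dots> \<in> nadic_ideal n"
    by (intro ideal_diff ideal_uminus ideal_slope n_ge_2 n_adic_of_int)
      (simp only: ideal_of_int[OF n_ge_2] dvd_refl)
  finally show ?case .
next
  case (lower m j)
  then show ?case by (simp add: pos_refine lab_even start_lower)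
next
  case (upper m j)
  define s where "s = lab m j"
  define e where "e = scale (m + 1) (2 * j)"
  have "pos (m + 1) (2 * j + 1) = pos m j + real n powi e * of_int (width (lower s))"
    by (simp add: pos_step pos_refine len_def lab_even s_def e_def)
  then have "pos (m + 1) (2 * j + 1) - of_int (start (upper s)) =
     (pos m j - of_int (start s)) + (real n powi e * of_int (width (lower s)) - of_int (width (lower s)))
      - of_int (start (upper s) - (start s + width (lower s)))" by simp
  also have "\<dots> \<in> nadic_ideal n"
    using ideal_diff[OF n_ge_2 ideal_add[OF n_ge_2 upper ideal_slope[OF n_ge_2 n_adic_of_int[OF n_ge_2]]]
      iffD2[OF ideal_of_int[OF n_ge_2] start_upper[OF valid_lab[of m j]]]]
    by (simp only: s_def)
  finally show ?case by (simp add: lab_odd s_def)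
qed

lemma pos_n_adic: "pos m j \<in> n_adic n"
  using n_adic_add[OF n_ge_2 ideal_n_adic[OF n_ge_2 pos_start[of m j]] n_adic_of_int[OF n_ge_2, of "start (lab m j)"]] by simp

text \<open>Width one makes \<open>n^e\<close> the length of such a cell.\<close>

definition unit_cell :: "real \<Rightarrow> int \<Rightarrow> bool" where
  "unit_cell p e \<longleftrightarrow> (\<exists>m j. pos m j = p \<and> width (lab m j) = 1 \<and> scale m j = e)"

text \<open>Cutting a cell of width greater than one keeps the unit, so after finitely many cuts only
  cells of width one and unchanged unit remain.\<close>

lemma cell_unit_cells:
  assumes "0 \<le> t" "t < width (lab m j)"
  shows "unit_cell (pos m j + of_int t * real n powi scale m j) (scale m j)"
  using assms
proof (induction "nat (width (lab m j))" arbitrary: m j t rule: less_induct)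
  case less
  show ?case
  proof (cases "width (lab m j) = 1")
    case True
    then have "t = 0" using less.prems by simp
    then show ?thesis using True by (auto simp: unit_cell_def)
  next
    case False
    define l u where "l = width (lab (m + 1) (2 * j))" "u = width (lab (m + 1) (2 * j + 1))"
    have lu: "l + u = width (lab m j)" "l \<ge> 1" "u \<ge> 1"
      using width_split[OF valid_lab, of m j] width_pos[OF valid_lab] False by (simp_all add: l_u_def lab_even lab_odd width_pos valid_lower_upper valid_lab)
    show ?thesis
    proof (cases "t < l")
      case True
      have "unit_cell (pos (m + 1) (2 * j) + of_int t * real n powi scale (m + 1) (2 * j)) (scale (m + 1) (2 * j))"
        by (rule less.hyps) (use lu True less.prems in \<open>auto simp: l_u_def\<close>)
      then show ?thesis using False by (simp add: pos_refine scale_child)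
    next
      case f: False
      have "unit_cell (pos (m + 1) (2 * j + 1) + of_int (t - l) * real n powi scale (m + 1) (2 * j + 1)) (scale (m + 1) (2 * j + 1))"
        by (rule less.hyps) (use lu f less.prems in \<open>auto simp: l_u_def\<close>)
      moreover have "pos (m + 1) (2 * j + 1) + of_int (t - l) * real n powi scale (m + 1) (2 * j + 1)
          = pos m j + of_int t * real n powi scale m j"
        using False by (simp add: pos_step pos_refine scale_child len_def l_u_def left_diff_distrib)
      ultimately show ?thesis using False by (simp only: scale_child) simp
    qed
  qed
qed

text \<open>One cut divides a cell of width one into two cells with total width \<open>n\<close> in the next smaller unit,
  and these dissolve into unit cells. So the binary rules reproduce the division into \<open>n\<close> equal parts.\<close>

lemma unit_cell_split:
  assumes "unit_cell p e" "0 \<le> t" "t < int n"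
  shows "unit_cell (p + of_int t * real n powi (e - 1)) (e - 1)"
proof -
  obtain m j where c: "pos m j = p" "width (lab m j) = 1" "scale m j = e"
    using assms by (auto simp: unit_cell_def)
  define l u where "l = width (lab (m + 1) (2 * j))" "u = width (lab (m + 1) (2 * j + 1))"
  have lu: "l + u = int n"
    using width_split[OF valid_lab, of m j] c by (auto simp: l_u_def lab_even lab_odd)
  show ?thesis
  proof (cases "t < l")
    case True
    then show ?thesis using cell_unit_cells[of t "m + 1" "2 * j"] assms c
      by (simp add: l_u_def pos_refine scale_child)
  next
    case False
    have "pos (m + 1) (2 * j + 1) + of_int (t - l) * real n powi scale (m + 1) (2 * j + 1)
        = p + of_int t * real n powi (e - 1)"
      using c by (simp add: pos_step pos_refine scale_child len_def l_u_def left_diff_distrib)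
    then show ?thesis using False cell_unit_cells[of "t - l" "m + 1" "2 * j + 1"] lu assms c
      by (simp add: l_u_def scale_child)
  qed
qed

lemma unit_cell_split_pow:
  assumes "unit_cell p e" "0 \<le> t" "t < int n ^ k"
  shows "unit_cell (p + of_int t * real n powi (e - int k)) (e - int k)"
  using assms(2,3)
proof (induction k arbitrary: t)
  case 0
  then have "t = 0" by simp
  then show ?case using assms(1) by simp
next
  case (Suc k)
  have "t div int n < int n ^ k"
  proof (rule ccontr)
    assume "\<not> t div int n < int n ^ k"
    then have "int n ^ k * int n \<le> (t div int n) * int n" by (intro mult_right_mono) auto
    also have "\<dots> \<le> t" using div_mult_mod_eq[of t "int n"] n_ge_4 pos_mod_sign[of "int n" t] by linarith
    finally show False using Suc.prems by (simp add: mult.commute)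
  qed
  then have "unit_cell (p + of_int (t div int n) * real n powi (e - int k)) (e - int k)"
    using Suc n_ge_4 by (simp add: pos_imp_zdiv_nonneg_iff)
  from unit_cell_split[OF this, of "t mod int n"]
  have "unit_cell (p + of_int (t div int n) * real n powi (e - int k) + of_int (t mod int n) * real n powi (e - int k - 1)) (e - int k - 1)"
    using n_ge_4 by simp
  moreover have "real_of_int t = of_int (t div int n) * real n + of_int (t mod int n)"
    by (metis div_mult_mod_eq of_int_add of_int_mult of_int_of_nat_eq)
  moreover have "real n powi (e - int k) = real n * real n powi (e - int k - 1)"
    using n_ge_4 by (simp add: power_int_diff)
  ultimately show ?case by (simp add: algebra_simps)
qed

text \<open>The unit cells at the origin have unbounded length, and repeated division into \<open>n\<close> parts reaches
  every n-adic interval from them.\<close>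

lemma unit_cell_all: "unit_cell (of_int a * real n powi e) e"
proof -
  obtain k where k: "\<bar>real_of_int a\<bar> < real n ^ k" using real_arch_pow[of "real n"] n_ge_4 by auto
  then have k': "\<bar>a\<bar> < int n ^ k" by (metis of_int_abs of_int_less_iff of_int_of_nat_eq of_int_power)
  show ?thesis
  proof (cases "a \<ge> 0")
    case True
    \<comment> \<open>The label at the origin is \<open>Lft 0\<close>, of width one, at the levels divisible by \<open>M\<close>.\<close>
    have "unit_cell 0 (e + int k)"
      unfolding unit_cell_def
      by (rule exI[of _ "- ((e + int k) * M)"], rule exI[of _ 0]) (use M_ge_2 in \<open>auto simp: state_0\<close>)
    from unit_cell_split_pow[OF this True, of k] k' True show ?thesis by simp
  next
    case False
    \<comment> \<open>At these levels the cell on the left of the origin has the label \<open>Rgt (M - 1)\<close>, of width one.\<close>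
    define m where "m = (M - 1) + M * (- (e + int k))"
    have m: "m div M = - (e + int k)" "m mod M = M - 1"
      unfolding m_def using M_ge_2 div_pos_pos_trivial[of "M - 1" M]
      by (simp_all only: div_mult_self2 mod_mult_self2) (simp_all add: zmod_minus1)
    have "unit_cell (- (real n powi (e + int k))) (e + int k)"
      unfolding unit_cell_def
      by (rule exI[of _ m], rule exI[of _ "-1"]) (use pos_step[of m "-1"] m in \<open>auto simp: state_m1 len_def add.commute\<close>)
    from unit_cell_split_pow[OF this, of "a + int n ^ k" k] k' False
    show ?thesis using n_ge_4 by (simp add: power_int_add algebra_simps)
  qed
qed

end

section \<open>Extending an order isomorphism between dense sets\<close>

text \<open>An order isomorphism between dense subsets of the line extends to all cuts. The sets are given by
  two families with the same index type, so that the isomorphism need not be named.\<close>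

lemma order_extension:
  fixes a b :: "'i \<Rightarrow> real"
  assumes le: "\<And>i j. a i \<le> a j \<longleftrightarrow> b i \<le> b j"
    and a: "\<And>x y. x < y \<Longrightarrow> \<exists>i. x < a i \<and> a i < y"
    and b: "\<And>x y. x < y \<Longrightarrow> \<exists>i. x < b i \<and> b i < y"
  obtains h :: "real \<Rightarrow> real" where "strict_mono h" "surj h" "\<And>i. h (a i) = b i"
proof -
  define h where "h x = Sup (b ` {i. a i \<le> x})" for x
  have lt: "a i < a j \<longleftrightarrow> b i < b j" for i j using le[of j i] by (simp add: not_le[symmetric])
  have upper: "b i \<le> h x" if "a i \<le> x" for i x
  proof -
    obtain k where "x < a k" using a[of x "x + 1"] by auto
    then have "bdd_above (b ` {i. a i \<le> x})"
      by (intro bdd_aboveI2[of _ _ "b k"]) (simp flip: le)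
    then show ?thesis unfolding h_def using that by (intro cSup_upper) auto
  qed
  have least: "h x \<le> z" if "\<And>i. a i \<le> x \<Longrightarrow> b i \<le> z" for x z
  proof -
    obtain k where "a k < x" using a[of "x - 1" x] by auto
    then show ?thesis unfolding h_def using that by (intro cSup_least) (auto intro: less_imp_le)
  qed
  have val: "h (a i) = b i" for i
    by (rule antisym) (auto intro: upper least simp: le)
  have mono: "strict_mono h"
  proof
    fix x y :: real assume "x < y"
    then obtain i where i: "x < a i" "a i < y" using a by blast
    then obtain j where j: "a i < a j" "a j < y" using a by blast
    have "h x \<le> b i" by (rule least) (use i le in force)
    also have "\<dots> < b j" using j lt by simp
    also have "\<dots> \<le> h y" using j upper by simp
    finally show "h x < h y" .
  qed
  have "surj h"
  proof (rule surjI)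
    fix z
    define x where "x = Sup (a ` {i. b i \<le> z})"
    obtain k where k: "z < b k" using b[of z "z + 1"] by auto
    have bdd: "bdd_above (a ` {i. b i \<le> z})"
      using k by (intro bdd_aboveI2[of _ _ "a k"]) (simp add: le)
    obtain k' where "b k' < z" using b[of "z - 1" z] by auto
    then have ne: "a ` {i. b i \<le> z} \<noteq> {}" by (auto intro: less_imp_le)
    show "h (Sup (a ` {i. b i \<le> z})) = z" unfolding x_def[symmetric]
    proof (rule ccontr)
      assume "h x \<noteq> z"
      then consider "h x < z" | "z < h x" by linarith
      then show False
      proof cases
        case 1
        then obtain i where i: "h x < b i" "b i < z" using b by blast
        then have "a i \<le> x" unfolding x_def by (intro cSup_upper bdd) auto
        then show False using upper[of i x] i by simp
      next
        case 2
        then obtain i where i: "z < b i" "b i < h x" using b by blast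
        have "x \<le> a i" unfolding x_def by (rule cSup_least[OF ne]) (use i le in force)
        then have "h x \<le> b i" by (intro least) (use le in force)
        then show False using i by simp
      qed
    qed
  qed
  then show ?thesis using that mono val by blast
qed

section \<open>Homeomorphisms that shift the labels of dyadic cells\<close>

abbreviation inverse_map :: "(real \<Rightarrow> real) \<Rightarrow> real \<Rightarrow> real" where
  "inverse_map f \<equiv> inv_into UNIV f"

definition dyadic :: "int \<Rightarrow> int \<Rightarrow> real" where
  "dyadic m j = of_int j * 2 powi (- m)"

lemma dyadic_less_iff [simp]: "dyadic m i < dyadic m j \<longleftrightarrow> i < j"
  and dyadic_le_iff [simp]: "dyadic m i \<le> dyadic m j \<longleftrightarrow> i \<le> j"
  and dyadic_eq_iff [simp]: "dyadic m i = dyadic m j \<longleftrightarrow> i = j"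
  by (simp_all add: dyadic_def)

lemma dyadic_refine: "dyadic (m + int d) (j * 2 ^ d) = dyadic m j"
  by (simp add: dyadic_def power_int_add power_int_minus power_int_diff field_simps)

lemma dyadic_sub: "dyadic (m + int d) (j * 2 ^ d + i) = dyadic m j + of_int i * 2 powi (- m - int d)"
  unfolding dyadic_refine[of m d j, symmetric] by (simp add: dyadic_def distrib_right)

text \<open>The interval from \<open>a\<close> to \<open>b\<close> contains \<open>x\<close> together with the points close to \<open>x\<close> on its right
  (if \<open>\<sigma>\<close> holds) or on its left. At each level exactly one cell has this property.\<close>

definition in_side :: "bool \<Rightarrow> real \<Rightarrow> real \<Rightarrow> real \<Rightarrow> bool" where
  "in_side \<sigma> a x b \<longleftrightarrow> (if \<sigma> then a \<le> x \<and> x < b else a < x \<and> x \<le> b)"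

lemma in_side_strict_mono:
  "strict_mono f \<Longrightarrow> in_side \<sigma> (f a) (f x) (f b) \<longleftrightarrow> in_side \<sigma> a x b"
  by (simp add: in_side_def strict_mono_less strict_mono_less_eq)

lemma in_side_closed: "in_side \<sigma> a x b \<Longrightarrow> x \<in> {a..b}"
  by (auto simp: in_side_def split: if_splits)

abbreviation in_cell :: "bool \<Rightarrow> real \<Rightarrow> int \<Rightarrow> int \<Rightarrow> bool" where
  "in_cell \<sigma> x m j \<equiv> in_side \<sigma> (dyadic m j) x (dyadic m (j + 1))"

lemma in_cell_ex: "\<exists>j. in_cell \<sigma> x m j"
proof -
  define z where "z = x * 2 powi m"
  have x: "x = z * 2 powi (- m)" by (simp add: z_def power_int_minus)
  show ?thesis
  proof (cases \<sigma>)
    case True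
    have "in_cell \<sigma> x m \<lfloor>z\<rfloor>"
      unfolding in_side_def dyadic_def x using True by simp
    then show ?thesis ..
  next
    case False
    have "in_cell \<sigma> x m (\<lceil>z\<rceil> - 1)"
      unfolding in_side_def dyadic_def x using False by simp linarith
    then show ?thesis ..
  qed
qed

lemma in_cell_unique: "in_cell \<sigma> x m i \<Longrightarrow> in_cell \<sigma> x m j \<Longrightarrow> i = j"
proof -
  assume "in_cell \<sigma> x m i" "in_cell \<sigma> x m j"
  then have "dyadic m i < dyadic m (j + 1)" "dyadic m j < dyadic m (i + 1)"
    unfolding in_side_def by (auto split: if_splits simp del: dyadic_less_iff dyadic_le_iff)
  then show "i = j" by simp
qed

lemma in_cell_refine:
  assumes "in_cell \<sigma> x m j"
  obtains i where "0 \<le> i" "i < 2 ^ d" "in_cell \<sigma> x (m + int d) (j * 2 ^ d + i)"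
proof -
  obtain c where c: "in_cell \<sigma> x (m + int d) c" using in_cell_ex by blast
  have "dyadic (m + int d) (j * 2 ^ d) < dyadic (m + int d) (c + 1)"
    "dyadic (m + int d) c < dyadic (m + int d) ((j + 1) * 2 ^ d)"
    using assms c unfolding in_side_def dyadic_refine by (auto split: if_splits)
  then have "j * 2 ^ d \<le> c" "c < j * 2 ^ d + 2 ^ d" by (simp_all add: distrib_right)
  then show ?thesis using that[of "c - j * 2 ^ d"] c by simp
qed

text \<open>The map \<open>g\<close> sends the dyadic cell \<open>(m, j)\<close> onto \<open>(m', j')\<close> by the increasing affine bijection.\<close>

definition carries :: "(real \<Rightarrow> real) \<Rightarrow> int \<Rightarrow> int \<Rightarrow> int \<Rightarrow> int \<Rightarrow> bool" where
  "carries g m j m' j' \<longleftrightarrow>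
     (\<forall>x\<in>{dyadic m j..dyadic m (j + 1)}. g x = dyadic m' j' + (x - dyadic m j) * 2 powi (m - m'))"

lemma cell_end: "dyadic m (j + 1) = dyadic m j + 2 powi (- m)"
  by (simp add: dyadic_def distrib_right)

lemma carries_ends:
  assumes "carries g m j m' j'"
  shows "g (dyadic m j) = dyadic m' j'" "g (dyadic m (j + 1)) = dyadic m' (j' + 1)"
proof -
  show "g (dyadic m j) = dyadic m' j'" using assms by (auto simp: carries_def)
  have "g (dyadic m (j + 1)) = dyadic m' j' + 2 powi (- m) * 2 powi (m - m')"
    using assms by (auto simp: carries_def cell_end)
  then show "g (dyadic m (j + 1)) = dyadic m' (j' + 1)"
    by (simp add: cell_end power_int_add[symmetric])
qed

lemma carries_in_cell:
  assumes "strict_mono g" "carries g m j m' j'"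
  shows "in_cell \<sigma> (g x) m' j' \<longleftrightarrow> in_cell \<sigma> x m j"
  using in_side_strict_mono[OF assms(1), of \<sigma> "dyadic m j" x "dyadic m (j + 1)"]
  by (simp add: carries_ends[OF assms(2)])

lemma carries_sub:
  assumes "carries g m j m' j'" "0 \<le> i" "i < 2 ^ d"
  shows "carries g (m + int d) (j * 2 ^ d + i) (m' + int d) (j' * 2 ^ d + i)"
  unfolding carries_def
proof
  fix x assume x: "x \<in> {dyadic (m + int d) (j * 2 ^ d + i)..dyadic (m + int d) (j * 2 ^ d + i + 1)}"
  have "dyadic m j \<le> dyadic (m + int d) (j * 2 ^ d + i)"
    using assms(2) unfolding dyadic_refine[of m d j, symmetric] by simp
  moreover have "dyadic (m + int d) (j * 2 ^ d + i + 1) \<le> dyadic m (j + 1)"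
    using assms(3) unfolding dyadic_refine[of m d "j + 1", symmetric] by (simp add: distrib_right)
  ultimately have "dyadic m j \<le> x \<and> x \<le> dyadic m (j + 1)"
    using x by (meson atLeastAtMost_iff order_trans)
  then have g: "g x = dyadic m' j' + (x - dyadic m j) * 2 powi (m - m')"
    using assms(1) unfolding carries_def by simp
  have p: "(2 :: real) powi (- m' - int d) = 2 powi (- m - int d) * 2 powi (m - m')"
  proof -
    have "- m' - int d = (- m - int d) + (m - m')" by simp
    then show ?thesis by (simp only:) (rule power_int_add, simp)
  qed
  have e: "m + int d - (m' + int d) = m - m'" by simp
  show "g x = dyadic (m' + int d) (j' * 2 ^ d + i) +
      (x - dyadic (m + int d) (j * 2 ^ d + i)) * 2 powi (m + int d - (m' + int d))"
    unfolding dyadic_sub g p e by (simp only: algebra_simps)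
qed

lemma carries_comp:
  assumes g: "strict_mono g" "carries g m j m' j'" and h: "carries h m' j' m'' j''"
  shows "carries (h \<circ> g) m j m'' j''"
  unfolding carries_def
proof
  fix x assume x: "x \<in> {dyadic m j..dyadic m (j + 1)}"
  then have "g x \<in> {g (dyadic m j)..g (dyadic m (j + 1))}"
    using g(1) by (simp add: strict_mono_less_eq)
  then have "h (g x) = dyadic m'' j'' + (g x - dyadic m' j') * 2 powi (m' - m'')"
    using h unfolding carries_ends[OF g(2)] by (auto simp: carries_def)
  also have "g x - dyadic m' j' = (x - dyadic m j) * 2 powi (m - m')"
    using g(2) x by (auto simp: carries_def)
  also have "(x - dyadic m j) * 2 powi (m - m') * 2 powi (m' - m'') = (x - dyadic m j) * 2 powi (m - m'')"
    by (simp add: mult.assoc power_int_add[symmetric])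
  finally show "(h \<circ> g) x = dyadic m'' j'' + (x - dyadic m j) * 2 powi (m - m'')" by simp
qed

lemma carries_inv:
  assumes g: "strict_mono g" "surj g" "carries g m j m' j'"
  shows "carries (inverse_map g) m' j' m j"
  unfolding carries_def
proof
  fix x assume x: "x \<in> {dyadic m' j'..dyadic m' (j' + 1)}"
  define u where "u = inverse_map g x"
  have gu: "g u = x" using g(2) by (simp add: u_def surj_f_inv_f)
  then have "u \<in> {dyadic m j..dyadic m (j + 1)}"
    using x unfolding carries_ends[OF g(3), symmetric] by (auto simp: strict_mono_less_eq[OF g(1)])
  then have "x = dyadic m' j' + (u - dyadic m j) * 2 powi (m - m')"
    using g(3) gu by (auto simp: carries_def)
  then have "(x - dyadic m' j') * 2 powi (m' - m) = (u - dyadic m j) * (2 powi (m - m') * 2 powi (m' - m))"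
    by simp
  then show "inverse_map g x = dyadic m j + (x - dyadic m' j') * 2 powi (m' - m)"
    by (simp add: u_def power_int_add[symmetric])
qed

lemma strict_mono_inv:
  fixes g :: "real \<Rightarrow> real"
  assumes "strict_mono g" "surj g" shows "strict_mono (inverse_map g)"
proof
  fix x y :: real assume "x < y"
  then have "g (inverse_map g x) < g (inverse_map g y)" by (simp only: surj_f_inv_f[OF assms(2)])
  then show "inverse_map g x < inverse_map g y" by (simp only: strict_mono_less[OF assms(1)])
qed

context subdivision
begin

text \<open>The index of labels is raised by \<open>k\<close>. Demanding this only for germs on either side of each point
  makes the condition local and independent of a choice of pieces.\<close>

definition shifting :: "int \<Rightarrow> (real \<Rightarrow> real) set" where
  "shifting k = {g. strict_mono g \<and> surj g \<and> (\<forall>\<sigma> x. \<exists>m j m' j'. in_cell \<sigma> x m j \<and>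
     carries g m j m' j' \<and> lab m' j' = rot k (lab m j))}"

lemma shiftingI:
  assumes "strict_mono g" "surj g"
    and "\<And>\<sigma> x. \<exists>m j m' j'. in_cell \<sigma> x m j \<and> carries g m j m' j' \<and> lab m' j' = rot k (lab m j)"
  shows "g \<in> shifting k"
  unfolding shifting_def mem_Collect_eq by (intro conjI allI) (rule assms)+

lemma shiftingE:
  assumes "g \<in> shifting k"
  obtains m j m' j' where "in_cell \<sigma> x m j" "carries g m j m' j'" "lab m' j' = rot k (lab m j)"
  using assms unfolding shifting_def by blast

lemma shiftingD: "g \<in> shifting k \<Longrightarrow> strict_mono g" "g \<in> shifting k \<Longrightarrow> surj g"
  by (simp_all add: shifting_def)

text \<open>The cell around a given germ can be replaced by any smaller one; source and target level then
  increase by the same amount.\<close>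

lemma shifting_deepE:
  assumes "g \<in> shifting k"
  shows "\<exists>m0 e. \<forall>d. \<exists>j j'. in_cell \<sigma> x (m0 + int d) j \<and>
    carries g (m0 + int d) j (m0 + e + int d) j' \<and> lab (m0 + e + int d) j' = rot k (lab (m0 + int d) j)"
proof -
  obtain m j m' j' where c: "in_cell \<sigma> x m j" "carries g m j m' j'" "lab m' j' = rot k (lab m j)"
    using assms by (rule shiftingE)
  have "\<exists>j j'. in_cell \<sigma> x (m + int d) j \<and>
    carries g (m + int d) j (m + (m' - m) + int d) j' \<and> lab (m + (m' - m) + int d) j' = rot k (lab (m + int d) j)" for d
  proof -
    obtain i where i: "0 \<le> i" "i < 2 ^ d" "in_cell \<sigma> x (m + int d) (j * 2 ^ d + i)"
      using in_cell_refine[OF c(1)] .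
    have "m + (m' - m) + int d = m' + int d" by simp
    then show ?thesis using i(3) carries_sub[OF c(2) i(1,2)] lab_shift[OF c(3) i(1,2)]
      by (intro exI[of _ "j * 2 ^ d + i"] exI[of _ "j' * 2 ^ d + i"]) (simp only: simp_thms)
  qed
  then show ?thesis by blast
qed

text \<open>The target cell of \<open>g\<close> and the source cell of \<open>h\<close> contain the same germ. They are brought to the same
  level, where they coincide.\<close>

lemma shifting_comp:
  assumes g: "g \<in> shifting k" and h: "h \<in> shifting l"
  shows "h \<circ> g \<in> shifting (k + l)"
proof -
  have "\<exists>m j m' j'. in_cell \<sigma> x m j \<and> carries (h \<circ> g) m j m' j' \<and> lab m' j' = rot (k + l) (lab m j)" for \<sigma> x
  proof -
    obtain m1 e1 where c1: "\<And>d. \<exists>j j'. in_cell \<sigma> x (m1 + int d) j \<and>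
      carries g (m1 + int d) j (m1 + e1 + int d) j' \<and> lab (m1 + e1 + int d) j' = rot k (lab (m1 + int d) j)"
      using shifting_deepE[OF g, of \<sigma> x] by blast
    obtain m2 e2 where c2: "\<And>d. \<exists>j j'. in_cell \<sigma> (g x) (m2 + int d) j \<and>
      carries h (m2 + int d) j (m2 + e2 + int d) j' \<and> lab (m2 + e2 + int d) j' = rot l (lab (m2 + int d) j)"
      using shifting_deepE[OF h, of \<sigma> "g x"] by blast
    define d1 d2 where "d1 = nat (m2 - (m1 + e1))" "d2 = nat ((m1 + e1) - m2)"
    define m where "m = m2 + int d2"
    have m: "m1 + e1 + int d1 = m" by (auto simp: d1_d2_def m_def)
    obtain j1 j1' where p1: "in_cell \<sigma> x (m1 + int d1) j1" "carries g (m1 + int d1) j1 m j1'"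
      "lab m j1' = rot k (lab (m1 + int d1) j1)"
      using c1[of d1] unfolding m by blast
    obtain j2 j2' where p2: "in_cell \<sigma> (g x) m j2" "carries h m j2 (m2 + e2 + int d2) j2'"
      "lab (m2 + e2 + int d2) j2' = rot l (lab m j2)"
      using c2[of d2] unfolding m_def[symmetric] by blast
    have "j2 = j1'"
      using p1 p2(1) carries_in_cell[OF shiftingD(1)[OF g]] in_cell_unique by blast
    then show ?thesis
      using p1 p2 carries_comp[OF shiftingD(1)[OF g] p1(2)] rot_add[of l k "lab (m1 + int d1) j1"]
      by (intro exI[of _ "m1 + int d1"] exI[of _ j1] exI[of _ "m2 + e2 + int d2"] exI[of _ j2'])
        (simp add: add.commute)
  qed
  moreover have "strict_mono (h \<circ> g)" using shiftingD(1)[OF g] shiftingD(1)[OF h] by (simp add: strict_mono_def)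
  moreover have "surj (h \<circ> g)" using shiftingD(2)[OF g] shiftingD(2)[OF h] by (rule comp_surj)
  ultimately show ?thesis by (intro shiftingI)
qed

lemma shifting_inv:
  assumes g: "g \<in> shifting k"
  shows "inverse_map g \<in> shifting (- k)"
proof -
  have "\<exists>m j m' j'. in_cell \<sigma> x m j \<and> carries (inverse_map g) m j m' j' \<and> lab m' j' = rot (- k) (lab m j)" for \<sigma> x
  proof -
    obtain m j m' j' where c: "in_cell \<sigma> (inverse_map g x) m j" "carries g m j m' j'" "lab m' j' = rot k (lab m j)"
      using g by (rule shiftingE)
    have "in_cell \<sigma> x m' j'"
      using carries_in_cell[OF shiftingD(1)[OF g] c(2), of \<sigma> "inverse_map g x"] c(1) shiftingD(2)[OF g] by (simp add: surj_f_inv_f)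
    moreover have "lab m j = rot (- k) (lab m' j')" by (simp add: c(3) rot_add rot_0 valid_lab)
    ultimately show ?thesis using carries_inv[OF shiftingD(1)[OF g] shiftingD(2)[OF g] c(2)]
      by (intro exI conjI)
  qed
  moreover have "surj (inverse_map g)" 
    by (rule inj_imp_surj_inv[OF strict_mono_imp_inj_on[OF shiftingD(1)[OF g]]])
  ultimately show ?thesis by (intro shiftingI strict_mono_inv[OF shiftingD(1)[OF g] shiftingD(2)[OF g]])
qed

lemma shifting_cong:
  assumes "M dvd k - l" shows "shifting k = shifting l"
proof -
  have "rot k (lab m j) = rot l (lab m j)" for m j
    by (simp only: rot_eq_iff[OF valid_lab] assms)
  then show ?thesis unfolding shifting_def by (simp only:)
qed

text \<open>At a deep level both memberships describe the same affine map on the same cell, so the target cell,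
  and with it the label, is the same for \<open>k\<close> and \<open>l\<close>.\<close>

lemma shifting_disjoint:
  assumes "g \<in> shifting k" "g \<in> shifting l" shows "M dvd k - l"
proof -
  obtain m1 e1 where c1: "\<And>d. \<exists>j j'. in_cell True 0 (m1 + int d) j \<and>
      carries g (m1 + int d) j (m1 + e1 + int d) j' \<and> lab (m1 + e1 + int d) j' = rot k (lab (m1 + int d) j)"
    using shifting_deepE[OF assms(1), of True 0] by blast
  obtain m2 e2 where c2: "\<And>d. \<exists>j j'. in_cell True 0 (m2 + int d) j \<and>
      carries g (m2 + int d) j (m2 + e2 + int d) j' \<and> lab (m2 + e2 + int d) j' = rot l (lab (m2 + int d) j)"
    using shifting_deepE[OF assms(2), of True 0] by blast
  \<comment> \<open>Truncation makes one of the two refinements trivial, and the levels agree afterwards.\<close>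
  define d1 d2 where "d1 = nat (m2 - m1)" "d2 = nat (m1 - m2)"
  define m where "m = m2 + int d2"
  have m: "m1 + int d1 = m" by (auto simp: d1_d2_def m_def)
  obtain j1 j1' where p1: "in_cell True 0 m j1" "carries g m j1 (m1 + e1 + int d1) j1'"
      "lab (m1 + e1 + int d1) j1' = rot k (lab m j1)"
    using c1[of d1] unfolding m by blast
  obtain j2 j2' where p2: "in_cell True 0 m j2" "carries g m j2 (m2 + e2 + int d2) j2'"
      "lab (m2 + e2 + int d2) j2' = rot l (lab m j2)"
    using c2[of d2] unfolding m_def[symmetric] by blast
  define m1' m2' where "m1' = m1 + e1 + int d1" "m2' = m2 + e2 + int d2"
  have j: "j2 = j1" using p1(1) p2(1) in_cell_unique by blast
  have e: "dyadic m1' j1' = dyadic m2' j2'" "dyadic m1' (j1' + 1) = dyadic m2' (j2' + 1)"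
    using carries_ends[OF p1(2)] carries_ends[OF p2(2)] by (simp_all add: j m1'_m2'_def)
  then have "(2::real) powi (- m1') = 2 powi (- m2')" unfolding cell_end by simp
  then have "m1' = m2'"
    using power_int_strict_increasing[of "- m1'" "- m2'" "2::real"] power_int_strict_increasing[of "- m2'" "- m1'" "2::real"]
    by (metis less_irrefl linorder_neqE neg_less_iff_less one_less_numeral_iff semiring_norm(76))
  moreover from this e have "j1' = j2'" by simp
  ultimately have "rot k (lab m j1) = rot l (lab m j1)" using p1(3) p2(3) j by (simp add: m1'_m2'_def)
  then show ?thesis by (rule iffD1[OF rot_eq_iff[OF valid_lab]])
qed

text \<open>At the origin the label \<open>Lft (- m)\<close> on the right and \<open>Rgt m\<close> on the left depend on the level only, and
  the relation is inherited by all descendants.\<close>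

lemma lab_dilate:
  "j \<ge> 0 \<Longrightarrow> lab (m - 1) j = rot 1 (lab m j)"
  "j < 0 \<Longrightarrow> lab (m + 1) j = rot 1 (lab m j)"
proof -
  have "(j \<ge> 0 \<longrightarrow> lab (m - 1) j = rot 1 (lab m j)) \<and> (j < 0 \<longrightarrow> lab (m + 1) j = rot 1 (lab m j))"
  proof (induction m j rule: cell_induct)
    case (lower m j)
    then show ?case
      using lab_even[of m j] lab_even[of "m - 1" j] lab_even[of "m + 1" j]
      by (auto simp: lower_upper_rot)
  next
    case (upper m j)
    have "2 * j + 1 \<ge> 0 \<longleftrightarrow> j \<ge> 0" by presburger
    then show ?case
      using upper lab_odd[of m j] lab_odd[of "m - 1" j] lab_odd[of "m + 1" j]
      by (auto simp: lower_upper_rot)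
  qed (auto simp: state_0 state_m1 rot_def mod_simps)
  then show "j \<ge> 0 \<Longrightarrow> lab (m - 1) j = rot 1 (lab m j)" "j < 0 \<Longrightarrow> lab (m + 1) j = rot 1 (lab m j)"
    by auto
qed

text \<open>Moving to the next coarser level on the right of the origin and to the next finer level on the left
  raises the index of every cell by one. On each side, this is a change of scale by \<open>2\<close>.\<close>

definition dilate :: "real \<Rightarrow> real" where
  "dilate x = (if x \<ge> 0 then 2 * x else x / 2)"

lemma dilate_shifting: "dilate \<in> shifting 1"
proof -
  have "\<exists>m j m' j'. in_cell \<sigma> x m j \<and> carries dilate m j m' j' \<and> lab m' j' = rot 1 (lab m j)" for \<sigma> x
  proof -
    \<comment> \<open>No cell has the origin in its interior, so the sign of \<open>j\<close> decides which formula applies.\<close>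
    obtain j where j: "in_cell \<sigma> x 0 j" using in_cell_ex by blast
    show ?thesis
    proof (cases "j \<ge> 0")
      case True
      then have "carries dilate 0 j (- 1) j"
        by (auto simp: carries_def dilate_def dyadic_def)
      then show ?thesis using j lab_dilate(1)[OF True, of 0] by (metis diff_0)
    next
      case False
      have "carries dilate 0 j 1 j"
        unfolding carries_def
      proof
        fix x assume "x \<in> {dyadic 0 j..dyadic 0 (j + 1)}"
        then have "x \<le> of_int (j + 1)" by (simp add: dyadic_def)
        also have "\<dots> \<le> 0" using False by linarith
        finally show "dilate x = dyadic 1 j + (x - dyadic 0 j) * 2 powi (0 - 1)"
          by (auto simp: dilate_def dyadic_def field_simps)
      qed
      then show ?thesis using j lab_dilate(2)[of j 0] False by (metis add_0 not_le)
    qed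
  qed
  moreover have "strict_mono dilate" by (auto simp: strict_mono_def dilate_def)
  moreover have "surj dilate"
    by (rule surjI[of _ "\<lambda>x. if x \<ge> 0 then x / 2 else 2 * x"]) (simp add: dilate_def)
  ultimately show ?thesis by (intro shiftingI)
qed

lemma dilate_power: "dilate ^^ k \<in> shifting (int k)"
proof (induction k)
  case 0
  have "carries id 0 j 0 j" for j by (simp add: carries_def)
  then have "\<exists>m j m' j'. in_cell \<sigma> x m j \<and> carries id m j m' j' \<and> lab m' j' = rot 0 (lab m j)" for \<sigma> x
    using in_cell_ex[of \<sigma> 0 x] rot_0[OF valid_lab] by metis
  moreover have "strict_mono (id :: real \<Rightarrow> real)" "surj (id :: real \<Rightarrow> real)" by (simp_all add: strict_mono_def)
  ultimately show ?case unfolding funpow.simps of_nat_0 by (intro shiftingI)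
next
  case (Suc k)
  then show ?case using shifting_comp[OF Suc dilate_shifting] by (simp only: funpow.simps of_nat_Suc add.commute)
qed

lemma dyadic_pos_le: "dyadic m i \<le> dyadic m' j \<longleftrightarrow> pos m i \<le> pos m' j"
proof -
  define d d' where "d = nat (m' - m)" "d' = nat (m - m')"
  have e: "m + int d = m' + int d'" by (auto simp: d_d'_def)
  have "dyadic m i \<le> dyadic m' j \<longleftrightarrow> i * 2 ^ d \<le> j * 2 ^ d'"
    unfolding dyadic_refine[of m d i, symmetric] dyadic_refine[of m' d' j, symmetric] e by simp
  also have "\<dots> \<longleftrightarrow> pos m i \<le> pos m' j"
    unfolding pos_refine_pow[of m d i, symmetric] pos_refine_pow[of m' d' j, symmetric] e
    by (simp flip: not_less add: pos_less_iff)
  finally show ?thesis .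
qed

text \<open>The homeomorphism that identifies the two models of the tree of cells.\<close>

definition \<Psi> :: "real \<Rightarrow> real" where
  "\<Psi> = (SOME h. strict_mono h \<and> surj h \<and> (\<forall>m j. h (dyadic m j) = pos m j))"

lemma \<Psi>: "strict_mono \<Psi>" "surj \<Psi>" "\<Psi> (dyadic m j) = pos m j"
proof -
  have dy: "\<exists>i. x < dyadic (fst i) (snd i) \<and> dyadic (fst i) (snd i) < y" if xy: "x < y" for x y
  proof -
    obtain z where z: "z \<in> n_adic 2" "x < z" "z < y" using n_adic_dense[of 2 x y] xy by auto
    then obtain a b where "z = dyadic (- b) a" by (auto simp: n_adic_def dyadic_def)
    then show ?thesis using z by (intro exI[of _ "(- b, a)"]) simp
  qed
  have po: "\<exists>i. x < pos (fst i) (snd i) \<and> pos (fst i) (snd i) < y" if xy: "x < y" for x y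
  proof -
    obtain z where z: "z \<in> n_adic n" "x < z" "z < y" using n_adic_dense[OF n_ge_2 xy] by auto
    then obtain a b where ab: "z = of_int a * real n powi b" by (auto simp: n_adic_def)
    obtain m j where "pos m j = z" using unit_cell_all[of a b] by (auto simp: unit_cell_def ab)
    then show ?thesis using z by (intro exI[of _ "(m, j)"]) simp
  qed
  obtain h :: "real \<Rightarrow> real" where "strict_mono h" "surj h"
     and "\<And>i. h (dyadic (fst i) (snd i)) = pos (fst i) (snd i)"
    using order_extension[OF dyadic_pos_le dy po] by blast
  then have "\<exists>h::real \<Rightarrow> real. strict_mono h \<and> surj h \<and> (\<forall>m j. h (dyadic m j) = pos m j)"
    by (metis fst_conv snd_conv)
  from someI_ex[OF this] show "strict_mono \<Psi>" "surj \<Psi>" "\<Psi> (dyadic m j) = pos m j"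
    unfolding \<Psi>_def by auto
qed

end

section \<open>Homeomorphisms with germs in the affine group modulo n - 1\<close>

text \<open>The homeomorphisms whose germs are affine with slope a power of \<open>n\<close> and with constant term in
  \<open>(n - 1) Z[1/n]\<close>, and which change slope only at n-adic points. This is a local description of the
  group, suited to comparison with cells.\<close>

definition ideal_germs :: "nat \<Rightarrow> (real \<Rightarrow> real) set" where
  "ideal_germs n = {f. strict_mono f \<and> surj f \<and>
     (\<forall>x. \<exists>\<epsilon>>0. \<exists>k l c d. c \<in> nadic_ideal n \<and> d \<in> nadic_ideal n \<and>
        (\<forall>z\<in>{x..x + \<epsilon>}. f z = real n powi k * z + c) \<and>
        (\<forall>z\<in>{x - \<epsilon>..x}. f z = real n powi l * z + d) \<and> (k = l \<or> x \<in> n_adic n))}"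

text \<open>The image is the whole line, so an increasing map cannot jump.\<close>

lemma strict_mono_surj_continuous:
  fixes f :: "real \<Rightarrow> real"
  assumes "strict_mono f" "surj f" shows "continuous_on UNIV f"
  by (rule continuous_onI_mono) (use assms in \<open>auto simp: strict_mono_less_eq\<close>)

context subdivision
begin

text \<open>On the dense set of descendants this is \<open>pos_self_similar\<close>; continuity of \<open>\<Psi>\<close> extends it to the whole
  cell.\<close>

lemma \<Psi>_self_similar:
  assumes lab: "lab m' j' = lab m j" and x: "x \<in> {dyadic m j..dyadic m (j + 1)}"
  shows "\<Psi> (dyadic m' j' + (x - dyadic m j) * 2 powi (m - m')) =
     pos m' j' + real n powi (scale m' j' - scale m j) * (\<Psi> x - pos m j)" (is "?F x = ?G x")
proof -
  have grid: "?F y = ?G y" if y: "y = dyadic (m + int d) (j * 2 ^ d + int i)" and i: "i \<le> 2 ^ d" for y d i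
  proof -
    have p: "(2 :: real) powi (- m' - int d) = 2 powi (- m - int d) * 2 powi (m - m')"
    proof -
      have "- m' - int d = (- m - int d) + (m - m')" by simp
      then show ?thesis by (simp only:) (rule power_int_add, simp)
    qed
    have "dyadic m' j' + (y - dyadic m j) * 2 powi (m - m') = dyadic (m' + int d) (j' * 2 ^ d + int i)"
      unfolding y dyadic_sub p by simp
    then show ?thesis using pos_self_similar[OF lab i] by (simp add: y \<Psi>(3))
  qed
  show ?thesis
  proof (cases "x = dyadic m (j + 1)")
    case True
    then show ?thesis using grid[of x 0 1] by simp
  next
    case False
    then have "in_cell True x m j" using x by (auto simp: in_side_def)
    then have "\<exists>i. 0 \<le> i \<and> i < 2 ^ d \<and> in_cell True x (m + int d) (j * 2 ^ d + i)" for d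
      by (rule in_cell_refine[where d = d]) blast
    then obtain i where i: "\<And>d. 0 \<le> i d" "\<And>d. i d < 2 ^ d" "\<And>d. in_cell True x (m + int d) (j * 2 ^ d + i d)"
      by metis
    define y where "y d = dyadic (m + int d) (j * 2 ^ d + i d)" for d
    have close: "y d \<le> x" "x \<le> y d + 2 powi (- m) * (1 / 2) ^ d" for d
    proof -
      have "(2 :: real) powi (- (m + int d)) = 2 powi (- m) * (1 / 2) ^ d"
        by (simp add: power_int_add power_int_minus power_int_diff field_simps)
      then show "y d \<le> x" "x \<le> y d + 2 powi (- m) * (1 / 2) ^ d"
        using i(3)[of d] cell_end[of "m + int d" "j * 2 ^ d + i d"] by (auto simp: in_side_def y_def)
    qed
    have lim: "y \<longlonglongrightarrow> x"
    proof (rule tendsto_sandwich)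
      show "(\<lambda>d. x - 2 powi (- m) * (1 / 2) ^ d) \<longlonglongrightarrow> x"
        by (auto intro!: tendsto_eq_intros LIMSEQ_realpow_zero)
      show "eventually (\<lambda>d. x - 2 powi (- m) * (1 / 2) ^ d \<le> y d) sequentially"
        using close(2) by (simp add: algebra_simps)
      show "eventually (\<lambda>d. y d \<le> x) sequentially" using close(1) by simp
    qed auto
    have cont: "isCont \<Psi> z" for z
      using strict_mono_surj_continuous[OF \<Psi>(1,2)] by (simp add: continuous_on_eq_continuous_at)
    have "(\<lambda>d. ?F (y d)) \<longlonglongrightarrow> ?F x"
      by (rule isCont_tendsto_compose[OF cont]) (intro tendsto_intros lim)
    moreover have "(\<lambda>d. ?G (y d)) \<longlonglongrightarrow> ?G x"
      by (intro tendsto_intros isCont_tendsto_compose[OF cont lim])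
    moreover have "?F (y d) = ?G (y d)" for d
      by (rule grid[of "y d" d "nat (i d)"])
        (use i[of d] in \<open>auto simp: y_def nat_le_iff less_imp_le\<close>)
    ultimately show ?thesis using LIMSEQ_unique by simp
  qed
qed

text \<open>On two cells with equal labels \<open>\<Psi>\<close> is the same function up to affine changes of source and target.
  Hence being affine from one cell onto the other means the same in both models.\<close>

lemma carries_iff_affine:
  assumes lab: "lab m' j' = lab m j" and f: "\<And>x. f (\<Psi> x) = \<Psi> (g x)"
  shows "carries g m j m' j' \<longleftrightarrow>
    (\<forall>z\<in>{pos m j..pos m (j + 1)}. f z = pos m' j' + real n powi (scale m' j' - scale m j) * (z - pos m j))"
    (is "_ \<longleftrightarrow> (\<forall>z\<in>_. f z = ?A z)")
proof
  assume c: "carries g m j m' j'"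
  show "\<forall>z\<in>{pos m j..pos m (j + 1)}. f z = ?A z"
  proof
    fix z assume z: "z \<in> {pos m j..pos m (j + 1)}"
    obtain x where x: "z = \<Psi> x" using \<Psi>(2) by blast
    then have "x \<in> {dyadic m j..dyadic m (j + 1)}"
      using z by (auto simp flip: \<Psi>(3) simp: strict_mono_less_eq[OF \<Psi>(1)])
    then show "f z = ?A z"
      using c \<Psi>_self_similar[OF lab] by (simp add: x f carries_def)
  qed
next
  assume A: "\<forall>z\<in>{pos m j..pos m (j + 1)}. f z = ?A z"
  show "carries g m j m' j'"
    unfolding carries_def
  proof
    fix x assume x: "x \<in> {dyadic m j..dyadic m (j + 1)}"
    then have "\<Psi> x \<in> {pos m j..pos m (j + 1)}"
      by (auto simp flip: \<Psi>(3) simp: strict_mono_less_eq[OF \<Psi>(1)])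
    then have "\<Psi> (g x) = \<Psi> (dyadic m' j' + (x - dyadic m j) * 2 powi (m - m'))"
      using A \<Psi>_self_similar[OF lab x] by (simp flip: f)
    then show "g x = dyadic m' j' + (x - dyadic m j) * 2 powi (m - m')"
      using strict_mono_eq[OF \<Psi>(1)] by blast
  qed
qed

lemma in_cell_\<Psi>: "in_cell \<sigma> u m j \<longleftrightarrow> in_side \<sigma> (pos m j) (\<Psi> u) (pos m (j + 1))"
  using in_side_strict_mono[OF \<Psi>(1), of \<sigma> "dyadic m j" u "dyadic m (j + 1)"] by (simp add: \<Psi>(3))

text \<open>An affine bijection between cells with equal labels has a power of \<open>n\<close> as slope, since widths
  agree, and a constant term in the ideal, since the left ends have the same class. Slopes change only
  at ends of cells, which are n-adic.\<close>

lemma shifting_imp_ideal_germs: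
  assumes g: "g \<in> shifting 0" and f: "\<And>x. f (\<Psi> x) = \<Psi> (g x)" and fm: "strict_mono f" "surj f"
  shows "f \<in> ideal_germs n"
proof -
  have side: "\<exists>a b k c. in_side \<sigma> a x b \<and> a \<in> n_adic n \<and> c \<in> nadic_ideal n \<and>
     (\<forall>z\<in>{a..b}. f z = real n powi k * z + c)" for \<sigma> x
  proof -
    obtain u where u: "x = \<Psi> u" using \<Psi>(2) by blast
    obtain m j m' j' where c: "in_cell \<sigma> u m j" "carries g m j m' j'" "lab m' j' = rot 0 (lab m j)"
      using g by (rule shiftingE)
    have lab: "lab m' j' = lab m j" using c(3) by (simp add: rot_0 valid_lab)
    define k where "k = scale m' j' - scale m j"
    define s where "s = real_of_int (start (lab m j))"
    have "pos m' j' - real n powi k * pos m j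
        = (pos m' j' - s) - (real n powi k * pos m j - pos m j) - (pos m j - s)" by simp
    also have "\<dots> \<in> nadic_ideal n"
      using ideal_diff[OF n_ge_2 ideal_diff[OF n_ge_2 pos_start[of m' j'] ideal_slope[OF n_ge_2 pos_n_adic[of m j]]] pos_start[of m j]]
      by (simp only: s_def lab)
    finally have "pos m' j' - real n powi k * pos m j \<in> nadic_ideal n" .
    moreover have "\<forall>z\<in>{pos m j..pos m (j + 1)}. f z = real n powi k * z + (pos m' j' - real n powi k * pos m j)"
      using c(2) unfolding carries_iff_affine[where f = f and g = g, OF lab f] k_def[symmetric] by (simp add: algebra_simps)
    ultimately show ?thesis
      using c(1) pos_n_adic unfolding in_cell_\<Psi> u by blast
  qed
  have "\<exists>\<epsilon>>0. \<exists>k l c d. c \<in> nadic_ideal n \<and> d \<in> nadic_ideal n \<and>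
        (\<forall>z\<in>{x..x + \<epsilon>}. f z = real n powi k * z + c) \<and>
        (\<forall>z\<in>{x - \<epsilon>..x}. f z = real n powi l * z + d) \<and> (k = l \<or> x \<in> n_adic n)" for x
  proof -
    obtain a b k c where r: "a \<le> x" "x < b" "a \<in> n_adic n" "c \<in> nadic_ideal n"
      "\<forall>z\<in>{a..b}. f z = real n powi k * z + c"
      using side[of True x] by (auto simp: in_side_def)
    show ?thesis
    proof (cases "a = x")
      case True
      obtain a' b' l d where l: "a' < x" "x \<le> b'" "d \<in> nadic_ideal n"
        "\<forall>z\<in>{a'..b'}. f z = real n powi l * z + d"
        using side[of False x] by (auto simp: in_side_def)
      show ?thesis
        by (rule exI[of _ "min (b - x) (x - a')"], intro conjI, use r l in simp,
            rule exI[of _ k], rule exI[of _ l], rule exI[of _ c], rule exI[of _ d])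
          (use True r l in auto)
    next
      case False
      show ?thesis
        by (rule exI[of _ "min (b - x) (x - a)"], intro conjI, use r False in simp,
            rule exI[of _ k], rule exI[of _ k], rule exI[of _ c], rule exI[of _ c])
          (use False r in auto)
    qed
  qed
  then show ?thesis unfolding ideal_germs_def mem_Collect_eq using fm by (intro conjI allI)
qed

lemma n_adic_grid:
  assumes h: "h > 0"
  obtains a :: int where "in_side \<sigma> (of_int a * h) x (of_int (a + 1) * h)"
proof (cases \<sigma>)
  case True
  have "of_int \<lfloor>x / h\<rfloor> \<le> x / h" "x / h < of_int (\<lfloor>x / h\<rfloor> + 1)" by linarith+
  then have "of_int \<lfloor>x / h\<rfloor> * h \<le> x" "x < of_int (\<lfloor>x / h\<rfloor> + 1) * h"
    by (simp_all only: pos_le_divide_eq[OF h] pos_divide_less_eq[OF h])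
  then show ?thesis using that[of "\<lfloor>x / h\<rfloor>"] True by (simp add: in_side_def)
next
  case False
  have "of_int (\<lceil>x / h\<rceil> - 1) < x / h" "x / h \<le> of_int (\<lceil>x / h\<rceil> - 1 + 1)"
    by linarith+
  then have "of_int (\<lceil>x / h\<rceil> - 1) * h < x" "x \<le> of_int (\<lceil>x / h\<rceil> - 1 + 1) * h"
    by (simp_all only: pos_less_divide_eq[OF h] pos_divide_le_eq[OF h])
  then show ?thesis using that[of "\<lceil>x / h\<rceil> - 1"] False by (simp add: in_side_def)
qed

lemma powi_small:
  assumes "\<epsilon> > 0"
  shows "\<exists>e0. \<forall>e\<le>e0. real n powi e < \<epsilon>"
proof -
  obtain k where k: "1 / \<epsilon> < real n ^ k" using real_arch_pow[of "real n"] n_ge_4 by auto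
  have "real n powi e < \<epsilon>" if "e \<le> - int k" for e
  proof -
    have "real n powi e \<le> real n powi (- int k)"
      using that n_ge_4 by (intro power_int_increasing) auto
    also have "\<dots> < \<epsilon>" using k assms n_ge_4 by (simp add: power_int_minus field_simps)
    finally show ?thesis .
  qed
  then show ?thesis by blast
qed

text \<open>Near a germ, a sufficiently small n-adic interval is mapped affinely onto another n-adic interval.
  Both are unit cells, and their left ends have the same class, so their labels agree.\<close>

lemma ideal_germs_imp_shifting:
  assumes f: "f \<in> ideal_germs n" and fg: "\<And>x. f (\<Psi> x) = \<Psi> (g x)" and g: "strict_mono g" "surj g"
  shows "g \<in> shifting 0"
proof (rule shiftingI[OF g])
  fix \<sigma> u
  define x where "x = \<Psi> u"
  obtain \<epsilon> k l c d where e: "\<epsilon> > 0" "c \<in> nadic_ideal n" "d \<in> nadic_ideal n"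
    "\<forall>z\<in>{x..x + \<epsilon>}. f z = real n powi k * z + c" "\<forall>z\<in>{x - \<epsilon>..x}. f z = real n powi l * z + d"
    "k = l \<or> x \<in> n_adic n"
    using f unfolding ideal_germs_def by blast
  define K C where "K = (if \<sigma> then k else l)" and "C = (if \<sigma> then c else d)"
  have C: "C \<in> nadic_ideal n" using e by (simp add: C_def)
  have aff: "f z = real n powi K * z + C"
    if "z \<in> {x - \<epsilon>..x + \<epsilon>}" "x \<in> n_adic n \<Longrightarrow> if \<sigma> then x \<le> z else z \<le> x" for z
  proof (cases "x \<in> n_adic n")
    case True
    then show ?thesis using that e by (cases \<sigma>) (auto simp: K_def C_def)
  next
    case False
    then have "k = l" using e by simp
    moreover from this e(1) e(4)[rule_format, of x] e(5)[rule_format, of x] have "c = d" by simp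
    ultimately show ?thesis using that(1) e(4,5) by (cases "x \<le> z") (auto simp: K_def C_def)
  qed
  obtain e0 where e0: "\<forall>e\<le>e0. real n powi e < \<epsilon>" using powi_small[OF e(1)] by blast
  obtain k1 where k1: "\<forall>q\<ge>k1. \<exists>a. C = of_int a * real n powi (- q)"
    using n_adic_expand[OF n_ge_2 ideal_n_adic[OF n_ge_2 C]] by blast
  obtain k2 where k2: "x \<in> n_adic n \<Longrightarrow> \<forall>q\<ge>k2. \<exists>a. x = of_int a * real n powi (- q)"
    using n_adic_expand[OF n_ge_2, of x] by blast
  \<comment> \<open>The grid is so fine that the interval fits into the neighbourhood, that its image has ends on a grid, and that \<open>x\<close> is a grid point if it is n-adic.\<close>
  define e where "e = min e0 (min (- k1 - K) (- k2))"
  define h where "h = real n powi e"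
  have h: "h > 0" "h < \<epsilon>" using e0 n_ge_4 by (auto simp: h_def e_def)
  obtain a where a: "in_side \<sigma> (of_int a * h) x (of_int (a + 1) * h)" using n_adic_grid[OF h(1)] .
  have "k1 \<le> - (e + K)" by (simp add: e_def)
  then have "\<exists>c1. C = of_int c1 * real n powi (- (- (e + K)))" using k1 by blast
  then obtain c1 where c1: "C = of_int c1 * real n powi (e + K)" by (auto simp only: minus_minus)
  have aff': "f z = real n powi K * z + C" if z: "z \<in> {of_int a * h..of_int (a + 1) * h}" for z
  proof (rule aff)
    show "z \<in> {x - \<epsilon>..x + \<epsilon>}"
      using z in_side_closed[OF a] h by (auto simp: algebra_simps)
    assume "x \<in> n_adic n"
    then obtain b where b: "x = of_int b * h" using k2[THEN spec, of "- e"] by (auto simp: h_def e_def)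
    show "if \<sigma> then x \<le> z else z \<le> x"
    proof (cases \<sigma>)
      case True
      then have "of_int b < (of_int (a + 1) :: real)" using a h by (simp add: in_side_def b)
      then have "b \<le> a" by linarith
      then have "x \<le> of_int a * h" using h by (simp add: b)
      then show ?thesis using z True by auto
    next
      case False
      then have "of_int a < (of_int b :: real)" using a h by (simp add: in_side_def b)
      then have "a + 1 \<le> b" by linarith
      then have "of_int (a + 1) * h \<le> x" unfolding b using h by (intro mult_right_mono) (simp_all del: of_int_add)
      then show ?thesis using z False by auto
    qed
  qed
  obtain m j where mj: "pos m j = of_int a * h" "width (lab m j) = 1" "scale m j = e"
    using unit_cell_all[of a e] by (auto simp: unit_cell_def h_def)
  obtain m' j' where mj': "pos m' j' = of_int (a + c1) * real n powi (e + K)" "width (lab m' j') = 1" "scale m' j' = e + K"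
    using unit_cell_all[of "a + c1" "e + K"] by (auto simp: unit_cell_def)
  have pos': "pos m' j' = real n powi K * pos m j + C"
    using n_ge_4 by (simp add: mj mj' c1 h_def power_int_add distrib_right)
  have "lab m' j' = lab m j"
  proof (rule label_unique[OF valid_lab valid_lab mj'(2) mj(2)])
    have "of_int (start (lab m' j') - start (lab m j)) =
       (real n powi K * pos m j - pos m j) + C - (pos m' j' - of_int (start (lab m' j'))) + (pos m j - of_int (start (lab m j)))"
      by (simp add: pos')
    also have "\<dots> \<in> nadic_ideal n"
      by (intro ideal_add[OF n_ge_2 ideal_diff[OF n_ge_2 ideal_add[OF n_ge_2 ideal_slope[OF n_ge_2 pos_n_adic] C] pos_start] pos_start])
    finally show "int n - 1 dvd start (lab m' j') - start (lab m j)"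
      by (simp only: ideal_of_int[OF n_ge_2])
  qed
  moreover have right_end: "pos m (j + 1) = of_int (a + 1) * h"
    by (simp add: pos_step mj len_def h_def distrib_right)
  moreover have "carries g m j m' j'"
    unfolding carries_iff_affine[where f = f and g = g, OF calculation(1) fg] right_end mj(1)
    using aff' by (simp add: pos' mj mj' algebra_simps)
  moreover have "in_cell \<sigma> u m j" unfolding in_cell_\<Psi> right_end mj(1) using a by (simp add: x_def)
  ultimately show "\<exists>m j m' j'. in_cell \<sigma> u m j \<and> carries g m j m' j' \<and> lab m' j' = rot 0 (lab m j)"
    using rot_0[OF valid_lab] by metis
qed

end

section \<open>The group B as a group of germs\<close>

context
  fixes n :: nat
  assumes n2: "n \<ge> 2"
begin

lemma ideal_germs_germ:
  assumes "f \<in> ideal_germs n"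
  obtains \<epsilon> k l c d where "\<epsilon> > 0" "c \<in> nadic_ideal n" "d \<in> nadic_ideal n"
    "\<forall>z\<in>{x..x + \<epsilon>}. f z = real n powi k * z + c"
    "\<forall>z\<in>{x - \<epsilon>..x}. f z = real n powi l * z + d" "k = l \<or> x \<in> n_adic n"
  using assms unfolding ideal_germs_def by blast

lemma ideal_germs_point:
  assumes "f \<in> ideal_germs n"
  obtains k c where "c \<in> nadic_ideal n" "f x = real n powi k * x + c"
proof -
  obtain \<epsilon> k c where "\<epsilon> > 0" "c \<in> nadic_ideal n" "\<forall>z\<in>{x..x + \<epsilon>}. f z = real n powi k * z + c"
    using ideal_germs_germ[OF assms] by metis
  then show ?thesis using that[of c k] by simp
qed

lemma ideal_germs_preserve_class:
  assumes f: "f \<in> ideal_germs n" and x: "x \<in> n_adic n"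
  shows "\<phi> n (f x) = \<phi> n x"
proof -
  obtain k c where c: "c \<in> nadic_ideal n" "f x = real n powi k * x + c"
    using f by (rule ideal_germs_point)
  have "f x - x = (real n powi k * x - x) + c" unfolding c(2) by simp
  also have "\<dots> \<in> nadic_ideal n" by (rule ideal_add[OF n2 ideal_slope[OF n2 x] c(1)])
  finally have "f x - x \<in> nadic_ideal n" .
  moreover have "f x \<in> n_adic n"
    unfolding c(2) by (rule n_adic_add[OF n2 n_adic_mult[OF n2 n_adic_powi[OF n2] x] ideal_n_adic[OF n2 c(1)]])
  ultimately show ?thesis using \<phi>_eq_iff[OF n2 _ x] by blast
qed

text \<open>The set of points around which the map is not affine serves both as the exceptional set of the piecewise linear
  structure and as the discrete set of n-adic numbers that contains the breaks.\<close>

lemma ideal_germs_imp_A_set: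
  assumes f: "f \<in> ideal_germs n"
  shows "f \<in> A_set n"
proof -
  have sm: "strict_mono f" and sj: "surj f" using f by (auto simp: ideal_germs_def)
  have cont: "continuous_on UNIV f" using strict_mono_surj_continuous[OF sm sj] .
  define S where "S = {x. \<not> (\<exists>\<epsilon>>0. \<exists>m c. \<forall>z\<in>{x - \<epsilon><..<x + \<epsilon>}. f z = m * z + c)}"
  have S_n_adic: "S \<subseteq> n_adic n"
  proof
    fix x assume x: "x \<in> S"
    obtain \<epsilon> k l c d where e: "\<epsilon> > 0"
      "\<forall>z\<in>{x..x + \<epsilon>}. f z = real n powi k * z + c" "\<forall>z\<in>{x - \<epsilon>..x}. f z = real n powi l * z + d"
      "k = l \<or> x \<in> n_adic n" using f by (rule ideal_germs_germ[where x = x])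
    show "x \<in> n_adic n"
    proof (rule ccontr)
      assume "x \<notin> n_adic n"
      then have "k = l" using e by simp
      moreover from this e(1) e(2)[rule_format, of x] e(3)[rule_format, of x] have "c = d" by simp
      ultimately have "f z = real n powi k * z + c" if "z \<in> {x - \<epsilon><..<x + \<epsilon>}" for z
        using e(2,3) that by (cases "x \<le> z") auto
      then show False using x e(1) unfolding S_def by blast
    qed
  qed
  have S_sparse: "S sparse_in UNIV"
    unfolding sparse_in_def
  proof
    fix x :: real
    obtain \<epsilon> k l c d where e: "\<epsilon> > 0"
      "\<forall>z\<in>{x..x + \<epsilon>}. f z = real n powi k * z + c" "\<forall>z\<in>{x - \<epsilon>..x}. f z = real n powi l * z + d"
      using f by (rule ideal_germs_germ[where x = x])
    have sub: "S \<inter> {x - \<epsilon><..<x + \<epsilon>} \<subseteq> {x}"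
    proof
      fix y assume y: "y \<in> S \<inter> {x - \<epsilon><..<x + \<epsilon>}"
      show "y \<in> {x}"
      proof (rule ccontr)
        assume "y \<notin> {x}"
        then consider "y < x" | "x < y" by fastforce
        then have "\<exists>\<delta>>0. \<exists>m c. \<forall>z\<in>{y - \<delta><..<y + \<delta>}. f z = m * z + c"
        proof cases
          case 1
          have "\<forall>z\<in>{y - min (x - y) (y - (x - \<epsilon>))<..<y + min (x - y) (y - (x - \<epsilon>))}. f z = real n powi l * z + d"
            by (intro ballI bspec[OF e(3)]) (auto simp: min_def split: if_splits)
          moreover have "min (x - y) (y - (x - \<epsilon>)) > 0" using 1 y by simp
          ultimately show ?thesis by blast
        next
          case 2
          have "\<forall>z\<in>{y - min (y - x) (x + \<epsilon> - y)<..<y + min (y - x) (x + \<epsilon> - y)}. f z = real n powi k * z + c"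
            by (intro ballI bspec[OF e(2)]) (auto simp: min_def split: if_splits)
          moreover have "min (y - x) (x + \<epsilon> - y) > 0" using 2 y by simp
          ultimately show ?thesis by blast
        qed
        then show False using y unfolding S_def by blast
      qed
    qed
    have "\<not> y islimpt S" if y: "y \<in> {x - \<epsilon><..<x + \<epsilon>}" for y
    proof
      assume "y islimpt S"
      moreover have "open ({x - \<epsilon><..<x + \<epsilon>} - ({x} - {y}))"
        by (intro open_Diff open_greaterThanLessThan finite_imp_closed) simp
      moreover have "y \<in> {x - \<epsilon><..<x + \<epsilon>} - ({x} - {y})" using y by blast
      ultimately obtain z where "z \<in> S" "z \<in> {x - \<epsilon><..<x + \<epsilon>} - ({x} - {y})" "z \<noteq> y"
        unfolding islimpt_def by meson
      then show False using sub by blast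
    qed
    then show "\<exists>B. x \<in> B \<and> open B \<and> (\<forall>y\<in>B. \<not> y islimpt S)"
      using e(1) by (intro exI[of _ "{x - \<epsilon><..<x + \<epsilon>}"]) auto
  qed
  have local_deriv: "\<exists>\<epsilon>>0. \<exists>m. \<forall>z\<in>{x - \<epsilon><..<x + \<epsilon>}. (f has_real_derivative m) (at z)" if x: "x \<notin> S" for x
  proof -
    obtain \<epsilon> m c where e: "\<epsilon> > 0" "\<forall>z\<in>{x - \<epsilon><..<x + \<epsilon>}. f z = m * z + c"
      using x unfolding S_def by blast
    have "(f has_real_derivative m) (at z)" if z: "z \<in> {x - \<epsilon><..<x + \<epsilon>}" for z
    proof (rule has_field_derivative_transform_within_open[where S = "{x - \<epsilon><..<x + \<epsilon>}"])
      show "((\<lambda>z. m * z + c) has_real_derivative m) (at z)"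
        by (auto intro!: derivative_eq_intros)
    qed (use e z in auto)
    then show ?thesis using e(1) by blast
  qed
  have breaks: "breaks f \<subseteq> S"
  proof
    fix x assume x: "x \<in> breaks f"
    show "x \<in> S"
    proof (rule ccontr)
      assume "x \<notin> S"
      then obtain \<epsilon> m where e: "\<epsilon> > 0" "\<forall>z\<in>{x - \<epsilon><..<x + \<epsilon>}. (f has_real_derivative m) (at z)"
        using local_deriv by blast
      then have "eventually (\<lambda>z. deriv f z = m) (nhds x)"
        by (intro eventually_nhds[THEN iffD2] exI[of _ "{x - \<epsilon><..<x + \<epsilon>}"]) (auto intro: DERIV_imp_deriv)
      then have "isCont (deriv f) x \<longleftrightarrow> isCont (\<lambda>_. m) x" by (rule isCont_cong)
      then show False using x by (simp add: breaks_def)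
    qed
  qed
  have "piecewise_linear f"
    unfolding piecewise_linear_def
  proof (intro conjI cont exI[of _ S] S_sparse allI impI)
    fix a b :: real
    assume ab: "a < b" "{a<..<b} \<inter> S = {}"
    define p where "p = (a + b) / 2"
    have p: "p \<in> {a<..<b}" using ab by (auto simp: p_def)
    have D: "(f has_real_derivative deriv f z) (at z)" if "z \<in> {a<..<b}" for z
    proof -
      have "z \<notin> S" using that ab by blast
      then obtain m where "(f has_real_derivative m) (at z)" using local_deriv[of z] by force
      then show ?thesis using DERIV_imp_deriv by metis
    qed
    have const: "deriv f z = deriv f p" if z: "z \<in> {a<..<b}" for z
    proof (rule connected_local_const[of "{a<..<b}" z p "deriv f"])
      show "\<forall>y\<in>{a<..<b}. eventually (\<lambda>w. deriv f y = deriv f w) (at y within {a<..<b})"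
      proof
        fix y assume "y \<in> {a<..<b}"
        then have "y \<notin> S" using ab by blast
        then obtain \<epsilon> m where e: "\<epsilon> > 0" "\<forall>z\<in>{y - \<epsilon><..<y + \<epsilon>}. (f has_real_derivative m) (at z)"
          using local_deriv by blast
        then have m: "deriv f z = m" if "z \<in> {y - \<epsilon><..<y + \<epsilon>}" for z
          using that by (auto intro: DERIV_imp_deriv)
        show "eventually (\<lambda>w. deriv f y = deriv f w) (at y within {a<..<b})"
          unfolding eventually_at_topological
          by (rule exI[of _ "{y - \<epsilon><..<y + \<epsilon>}"]) (use e(1) in \<open>auto simp: m\<close>)
      qed
    qed (use p z in auto)
    have "f z = deriv f p * z + (f p - deriv f p * p)" if z: "z \<in> {a<..<b}" for z
    proof -
      have "\<exists>C. \<forall>z\<in>{a<..<b}. f z - deriv f p * z = C"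
      proof (rule has_field_derivative_zero_constant)
        fix z assume z: "z \<in> {a<..<b}"
        show "((\<lambda>z. f z - deriv f p * z) has_real_derivative 0) (at z within {a<..<b})"
          using D[OF z] by (auto intro!: derivative_eq_intros intro: has_field_derivative_at_within simp: const[OF z])
      qed auto
      then have "f z - deriv f p * z = f p - deriv f p * p" using z p by auto
      then show ?thesis by simp
    qed
    then show "\<exists>m c. \<forall>z\<in>{a<..<b}. f z = m * z + c" by blast
  qed
  moreover have "homeomorphism UNIV UNIV f (inverse_map f)"
    unfolding homeomorphism_def
  proof (intro conjI ballI)
    have inj: "inj f" using sm by (rule strict_mono_imp_inj_on)
    show "inverse_map f ` UNIV = UNIV" using inj by (rule inj_imp_surj_inv)
    show "continuous_on UNIV (inverse_map f)"
      by (rule strict_mono_surj_continuous[OF strict_mono_inv[OF sm sj] inj_imp_surj_inv[OF inj]])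
    show "inverse_map f (f x) = x" for x using inj by (rule inv_f_f)
    show "f (inverse_map f y) = y" for y using sj by (rule surj_f_inv_f)
  qed (use sj cont in auto)
  moreover have "m \<in> n_powers n" if D: "(f has_real_derivative m) (at x)" for x m
  proof -
    obtain \<epsilon> k c where e: "\<epsilon> > 0" "\<forall>z\<in>{x..x + \<epsilon>}. f z = real n powi k * z + c"
      using f by (rule ideal_germs_germ[where x = x])
    have "((\<lambda>z. real n powi k * z + c) has_real_derivative real n powi k) (at x within {x..x + \<epsilon>})"
      by (auto intro!: derivative_eq_intros)
    then have "(f has_real_derivative real n powi k) (at x within {x..x + \<epsilon>})"
      by (rule has_field_derivative_transform_within[where d = 1]) (use e in auto)
    moreover have "(f has_real_derivative m) (at x within {x..x + \<epsilon>})"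
      using D by (rule has_field_derivative_at_within)
    moreover have "at x within {x..x + \<epsilon>} \<noteq> bot"
      using e(1) at_within_Icc_at_right[of x "x + \<epsilon>"] by simp
    ultimately have "m = real n powi k" using has_field_derivative_unique by blast
    then show ?thesis by (simp add: n_powers_def)
  qed
  moreover have "f ` n_adic n = n_adic n"
  proof (intro equalityI subsetI)
    fix y assume "y \<in> f ` n_adic n"
    then obtain x where x: "x \<in> n_adic n" "y = f x" by blast
    obtain k c where c: "c \<in> nadic_ideal n" "f x = real n powi k * x + c" using f by (rule ideal_germs_point[where x = x])
    show "y \<in> n_adic n"
      unfolding x(2) c(2) by (rule n_adic_add[OF n2 n_adic_mult[OF n2 n_adic_powi[OF n2] x(1)] ideal_n_adic[OF n2 c(1)]])
  next
    fix y assume y: "y \<in> n_adic n"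
    obtain x where x: "y = f x" using sj by blast
    obtain k c where c: "c \<in> nadic_ideal n" "f x = real n powi k * x + c" using f by (rule ideal_germs_point[where x = x])
    have "x = real n powi (- k) * (y - c)" using n2 by (simp add: x c(2) power_int_minus)
    also have "\<dots> \<in> n_adic n"
      by (rule n_adic_mult[OF n2 n_adic_powi[OF n2] n_adic_diff[OF n2 y ideal_n_adic[OF n2 c(1)]]])
    finally show "y \<in> f ` n_adic n" using x by blast
  qed
  ultimately show "f \<in> A_set n"
    unfolding A_set_def using sm breaks S_n_adic S_sparse
    by (intro CollectI conjI exI[of _ S] exI[of _ "inverse_map f"] allI impI)
qed

text \<open>On either side of a point the map is affine, and it maps some n-adic point of that side to an n-adic
  point, so its constant term is n-adic. If the two slopes differ, the derivative is discontinuous.\<close>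

lemma A_set_germ:
  assumes f: "f \<in> A_set n"
  shows "\<exists>\<epsilon>>0. \<exists>k l c d. c \<in> n_adic n \<and> d \<in> n_adic n \<and>
        (\<forall>z\<in>{x..x + \<epsilon>}. f z = real n powi k * z + c) \<and>
        (\<forall>z\<in>{x - \<epsilon>..x}. f z = real n powi l * z + d) \<and> (k = l \<or> x \<in> n_adic n)"
proof -
  have sm: "strict_mono f" and slopes: "\<And>x m. (f has_real_derivative m) (at x) \<Longrightarrow> m \<in> n_powers n"
    and breaks: "breaks f \<subseteq> n_adic n" and im: "f ` n_adic n = n_adic n"
    and cont: "continuous_on UNIV f"
    using f unfolding A_set_def piecewise_linear_def by auto
  obtain S where S: "S sparse_in UNIV"
    "\<And>a b. a < b \<Longrightarrow> {a<..<b} \<inter> S = {} \<Longrightarrow> \<exists>m c. \<forall>x\<in>{a<..<b}. f x = m * x + c"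
    using f unfolding A_set_def piecewise_linear_def by auto
  have affine: "\<exists>k c. c \<in> n_adic n \<and> (\<forall>z\<in>{a..b}. f z = real n powi k * z + c) \<and>
      (\<forall>z\<in>{a<..<b}. deriv f z = real n powi k)"
    if ab: "a < b" "{a<..<b} \<inter> S = {}" for a b
  proof -
    obtain m c where mc: "\<forall>x\<in>{a<..<b}. f x = m * x + c" using S(2)[OF ab] by blast
    have D: "(f has_real_derivative m) (at z)" if z: "z \<in> {a<..<b}" for z
    proof (rule has_field_derivative_transform_within_open[where S = "{a<..<b}"])
      show "((\<lambda>z. m * z + c) has_real_derivative m) (at z)"
        by (auto intro!: derivative_eq_intros)
    qed (use mc z in auto)
    obtain p where p: "p \<in> n_adic n" "a < p" "p < b" using n_adic_dense[OF n2 ab(1)] by blast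
    then obtain k where k: "m = real n powi k" using slopes[OF D[of p]] by (auto simp: n_powers_def)
    have "f p \<in> n_adic n" using p im by blast
    moreover have "c = f p - real n powi k * p" using mc p k by simp
    ultimately have "c \<in> n_adic n" by (auto intro!: n_adic_diff n_adic_mult n2 n_adic_powi p)
    moreover have "f z = real n powi k * z + c" if z: "z \<in> {a..b}" for z
    proof -
      have "f z - (m * z + c) = 0"
      proof (rule continuous_constant_on_closure[of "{a<..<b}" "\<lambda>z. f z - (m * z + c)"])
        show "continuous_on (closure {a<..<b}) (\<lambda>z. f z - (m * z + c))"
          by (intro continuous_intros continuous_on_subset[OF cont]) auto
        show "z \<in> closure {a<..<b}" using z ab(1) by simp
      qed (use mc in auto)
      then show ?thesis by (simp add: k)
    qed
    ultimately show ?thesis using DERIV_imp_deriv[OF D] k by auto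
  qed
  have "\<not> x islimpt S" using S(1) by (auto simp: sparse_in_def)
  then obtain \<epsilon> where e: "\<epsilon> > 0" "\<And>y. y \<in> S \<Longrightarrow> y \<noteq> x \<Longrightarrow> \<not> dist y x < \<epsilon>"
    unfolding islimpt_approachable by blast
  have "y \<notin> S" if "y \<noteq> x" "x - \<epsilon> < y" "y < x + \<epsilon>" for y
    using e(2)[of y] that by (auto simp: dist_real_def)
  then have "{x<..<x + \<epsilon>} \<inter> S = {}" "{x - \<epsilon><..<x} \<inter> S = {}"
    using e(1) by force+
  then obtain k c l d where r: "c \<in> n_adic n" "\<forall>z\<in>{x..x + \<epsilon>}. f z = real n powi k * z + c"
      "\<forall>z\<in>{x<..<x + \<epsilon>}. deriv f z = real n powi k"
    and l: "d \<in> n_adic n" "\<forall>z\<in>{x - \<epsilon>..x}. f z = real n powi l * z + d"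
      "\<forall>z\<in>{x - \<epsilon><..<x}. deriv f z = real n powi l"
    using affine[of x "x + \<epsilon>"] affine[of "x - \<epsilon>" x] e(1) by auto
  have "x \<in> breaks f" if "k \<noteq> l"
    unfolding breaks_def mem_Collect_eq
  proof
    assume "isCont (deriv f) x"
    then have lim: "(deriv f \<longlongrightarrow> deriv f x) (at_right x)" "(deriv f \<longlongrightarrow> deriv f x) (at_left x)"
      unfolding isCont_def by (auto intro: tendsto_within_subset)
    have "((\<lambda>_. real n powi k) \<longlongrightarrow> deriv f x) (at_right x)"
      using r(3) e(1) by (intro Lim_transform_eventually[OF lim(1)])
        (auto simp: eventually_at_right_field intro!: exI[of _ "x + \<epsilon>"])
    moreover have "((\<lambda>_. real n powi l) \<longlongrightarrow> deriv f x) (at_left x)"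
      using l(3) e(1) by (intro Lim_transform_eventually[OF lim(2)])
        (auto simp: eventually_at_left_field intro!: exI[of _ "x - \<epsilon>"])
    ultimately have "real n powi k = real n powi l"
      by (simp add: tendsto_const_iff)
    then show False
      using power_int_strict_increasing[of k l "real n"] power_int_strict_increasing[of l k "real n"] n2 that
      by (cases "k < l") auto
  qed
  then have "k = l \<or> x \<in> n_adic n" using breaks by blast
  then show ?thesis using e(1) r(1,2) l(1,2) by blast
qed

lemma \<phi>_diff:
  assumes "x \<in> n_adic n" "y \<in> n_adic n"
  shows "\<phi> n (x - y) = (\<phi> n x - \<phi> n y) mod (int n - 1)"
proof -
  obtain a b k where xy: "x = of_int a * real n powi k" "y = of_int b * real n powi k"
    using n_adic_common[OF n2] assms by metis
  then have "x - y = of_int (a - b) * real n powi k" by (simp add: left_diff_distrib)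
  then show ?thesis by (simp only: xy \<phi>_eq[OF n2] mod_diff_eq)
qed

lemma \<phi>_eq_0: "x \<in> n_adic n \<Longrightarrow> \<phi> n x = 0 \<longleftrightarrow> x \<in> nadic_ideal n"
  using \<phi>_eq_iff[OF n2, of x 0] \<phi>_eq[OF n2, of 0 0] n_adic_of_int[OF n2, of 0] by simp

text \<open>On one side of a point, \<open>f p - p\<close> has the class of the constant term of the germ for all n-adic \<open>p\<close>. The two
  sides of a point agree by evaluation at the point itself if it is n-adic, and because there
  is only one germ otherwise. So the class of the displacement is locally constant, hence constant.\<close>

lemma A_set_displacement_constant:
  assumes f: "f \<in> A_set n"
  shows "\<exists>r. \<forall>x\<in>n_adic n. \<phi> n (f x - x) = r"
proof -
  have im: "f ` n_adic n = n_adic n" using f by (simp add: A_set_def)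
  have "\<exists>\<epsilon>>0. \<exists>c\<in>n_adic n. \<forall>p\<in>n_adic n. \<bar>p - x\<bar> < \<epsilon> \<longrightarrow> f p - p - c \<in> nadic_ideal n" for x
  proof -
    obtain \<epsilon> k l c d where e: "\<epsilon> > 0" "c \<in> n_adic n" "d \<in> n_adic n"
      "\<forall>z\<in>{x..x + \<epsilon>}. f z = real n powi k * z + c" "\<forall>z\<in>{x - \<epsilon>..x}. f z = real n powi l * z + d"
      "k = l \<or> x \<in> n_adic n" using A_set_germ[OF f, of x] by blast
    have right: "f p - p - c \<in> nadic_ideal n" if "p \<in> n_adic n" "x \<le> p" "p \<le> x + \<epsilon>" for p
      using ideal_slope[OF n2 that(1), of k] e(4) that by simp
    have left: "f p - p - d \<in> nadic_ideal n" if "p \<in> n_adic n" "x - \<epsilon> \<le> p" "p \<le> x" for p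
      using ideal_slope[OF n2 that(1), of l] e(5) that by simp
    have dc: "d - c \<in> nadic_ideal n"
    proof (cases "x \<in> n_adic n")
      case True
      then show ?thesis using ideal_diff[OF n2 right[of x] left[of x]] e(1) by simp
    next
      case False
      then have "k = l" using e(6) by simp
      then have "c = d" using e(1) e(4)[rule_format, of x] e(5)[rule_format, of x] by simp
      then show ?thesis using ideal_zero[OF n2] by simp
    qed
    have "f p - p - c \<in> nadic_ideal n" if p: "p \<in> n_adic n" "\<bar>p - x\<bar> < \<epsilon>" for p
    proof (cases "x \<le> p")
      case True
      then show ?thesis using right p by auto
    next
      case False
      then show ?thesis using ideal_add[OF n2 left[of p] dc] p by (auto simp: algebra_simps)
    qed
    then show ?thesis using e(1,2) by blast
  qed
  then obtain \<epsilon> C where C: "\<And>x. \<epsilon> x > 0" "\<And>x. C x \<in> n_adic n"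
    "\<And>x p. p \<in> n_adic n \<Longrightarrow> \<bar>p - x\<bar> < \<epsilon> x \<Longrightarrow> f p - p - C x \<in> nadic_ideal n" by metis
  have fp: "f p - p \<in> n_adic n" if "p \<in> n_adic n" for p
    using that im by (intro n_adic_diff n2) auto
  have near: "\<phi> n (f p - p) = \<phi> n (C x)" if "p \<in> n_adic n" "\<bar>p - x\<bar> < \<epsilon> x" for p x
    using \<phi>_eq_iff[OF n2 fp C(2)] C(3) that by blast
  have const: "\<phi> n (C x) = \<phi> n (C 0)" for x
  proof (rule connected_local_const[of UNIV x 0 "\<lambda>x. \<phi> n (C x)"])
    show "\<forall>x\<in>UNIV. eventually (\<lambda>w. \<phi> n (C x) = \<phi> n (C w)) (at x within UNIV)"
    proof
      fix x
      have "\<phi> n (C x) = \<phi> n (C w)" if w: "dist w x < \<epsilon> x" for w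
      proof -
        have "max (x - \<epsilon> x) (w - \<epsilon> w) < min (x + \<epsilon> x) (w + \<epsilon> w)"
          using w C(1)[of x] C(1)[of w] by (auto simp: dist_real_def)
        then obtain p where "p \<in> n_adic n" "max (x - \<epsilon> x) (w - \<epsilon> w) < p" "p < min (x + \<epsilon> x) (w + \<epsilon> w)"
          using n_adic_dense[OF n2] by blast
        then show ?thesis using near[of p x] near[of p w] by (simp add: abs_less_iff)
      qed
      then show "eventually (\<lambda>w. \<phi> n (C x) = \<phi> n (C w)) (at x within UNIV)"
        unfolding eventually_at using C(1) by blast
    qed
  qed auto
  have "\<phi> n (f x - x) = \<phi> n (C 0)" if "x \<in> n_adic n" for x
    using near[OF that, of x] C(1)[of x] const[of x] by simp
  then show ?thesis by blast
qed

text \<open>If \<open>\<rho>\<close> vanishes, the map preserves classes of n-adic numbers; evaluation at an n-adic point then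
  puts the constant term of a germ into the ideal.\<close>

lemma carrier_B_group: "carrier (B_group n) = ideal_germs n"
proof -
  have "carrier (B_group n) = {f \<in> A_set n. \<rho> n f = 0}"
    by (auto simp: B_group_def kernel_def A_group_def integer_mod_group_def integer_group_def)
  also have "\<dots> = ideal_germs n"
  proof (intro equalityI subsetI)
    fix f assume f: "f \<in> ideal_germs n"
    have "\<rho> n f = 0"
      unfolding \<rho>_def
    proof (rule the_equality)
      show "\<forall>x\<in>n_adic n. 0 = (\<phi> n (f x) - \<phi> n x) mod (int n - 1)"
        using ideal_germs_preserve_class[OF f] by simp
      then show "r = 0" if "\<forall>x\<in>n_adic n. r = (\<phi> n (f x) - \<phi> n x) mod (int n - 1)" for r
        using bspec[OF that n_adic_of_int[OF n2, of 0]]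
          ideal_germs_preserve_class[OF f n_adic_of_int[OF n2, of 0]] by simp
    qed
    then show "f \<in> {f \<in> A_set n. \<rho> n f = 0}" using ideal_germs_imp_A_set[OF f] by simp
  next
    fix f assume "f \<in> {f \<in> A_set n. \<rho> n f = 0}"
    then have f: "f \<in> A_set n" "\<rho> n f = 0" by auto
    have im: "f ` n_adic n = n_adic n" using f(1) by (simp add: A_set_def)
    obtain r where r: "\<forall>x\<in>n_adic n. \<phi> n (f x - x) = r"
      using A_set_displacement_constant[OF f(1)] by blast
    have const: "\<forall>x\<in>n_adic n. r = (\<phi> n (f x) - \<phi> n x) mod (int n - 1)"
    proof
      fix x assume x: "x \<in> n_adic n"
      then have fx: "f x \<in> n_adic n" using im by blast
      show "r = (\<phi> n (f x) - \<phi> n x) mod (int n - 1)"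
        by (rule trans[OF bspec[OF r x, symmetric] \<phi>_diff[OF fx x]])
    qed
    then have "\<rho> n f = r"
      unfolding \<rho>_def
    proof (rule the_equality)
      show "s = r" if "\<forall>x\<in>n_adic n. s = (\<phi> n (f x) - \<phi> n x) mod (int n - 1)" for s
        by (rule trans[OF bspec[OF that n_adic_of_int[OF n2, of 0]]
            bspec[OF const n_adic_of_int[OF n2, of 0], symmetric]])
    qed
    then have "r = 0" using f(2) by simp
    have fixed: "f x - x \<in> nadic_ideal n" if x: "x \<in> n_adic n" for x
    proof -
      have "f x - x \<in> n_adic n" using im x by (intro n_adic_diff n2) blast+
      then show ?thesis using bspec[OF r x] \<phi>_eq_0[of "f x - x"] \<open>r = 0\<close> by simp
    qed
    have ideal: "c \<in> nadic_ideal n"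
      if ab: "a < b" "\<forall>z\<in>{a..b}. f z = real n powi k * z + c" for a b k c
    proof -
      obtain p where p: "p \<in> n_adic n" "a < p" "p < b" using n_adic_dense[OF n2 ab(1)] by blast
      have "c = (f p - p) - (real n powi k * p - p)" using ab(2) p by simp
      also have "\<dots> \<in> nadic_ideal n" by (intro ideal_diff fixed ideal_slope n2 p)
      finally show ?thesis .
    qed
    have "\<exists>\<epsilon>>0. \<exists>k l c d. c \<in> nadic_ideal n \<and> d \<in> nadic_ideal n \<and>
        (\<forall>z\<in>{x..x + \<epsilon>}. f z = real n powi k * z + c) \<and>
        (\<forall>z\<in>{x - \<epsilon>..x}. f z = real n powi l * z + d) \<and> (k = l \<or> x \<in> n_adic n)" for x
    proof -
      obtain \<epsilon> k l c d where e: "\<epsilon> > 0"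
        "\<forall>z\<in>{x..x + \<epsilon>}. f z = real n powi k * z + c" "\<forall>z\<in>{x - \<epsilon>..x}. f z = real n powi l * z + d"
        "k = l \<or> x \<in> n_adic n" using A_set_germ[OF f(1), of x] by blast
      moreover have "c \<in> nadic_ideal n" "d \<in> nadic_ideal n"
        using ideal[OF _ e(2)] ideal[OF _ e(3)] e(1) by auto
      ultimately show ?thesis by blast
    qed
    moreover have "strict_mono f" "surj f"
      using f(1) unfolding A_set_def homeomorphism_def by auto
    ultimately show "f \<in> ideal_germs n" unfolding ideal_germs_def mem_Collect_eq by (intro conjI allI)
  qed
  finally show ?thesis .
qed

end

section \<open>The exotic automorphism\<close>

lemma affine_in_ideal_germs:
  assumes "n \<ge> 2" "c \<in> nadic_ideal n"
  shows "(\<lambda>x. real n powi k * x + c) \<in> ideal_germs n"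
proof -
  have "strict_mono (\<lambda>x. real n powi k * x + c)"
    using assms(1) by (auto simp: strict_mono_def)
  moreover have "surj (\<lambda>x. real n powi k * x + c)"
    by (rule surjI[of _ "\<lambda>y. (y - c) / real n powi k"]) (use assms(1) in simp)
  ultimately show ?thesis
    unfolding ideal_germs_def mem_Collect_eq
    by (intro conjI allI exI[of _ 1] exI[of _ k] exI[of _ c]) (use assms(2) in auto)
qed

text \<open>The group contains multiplication by \<open>n\<close>, whose only fixed point is \<open>0\<close>, and the translations by the
  dense set \<open>(n - 1) Z[1/n]\<close>. A map that commutes with them fixes \<open>0\<close> and therefore this dense set.\<close>

lemma centraliser_trivial:
  assumes n2: "n \<ge> 2" and h: "strict_mono h"
    and comm: "\<And>f. f \<in> ideal_germs n \<Longrightarrow> h \<circ> f = f \<circ> h"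
  shows "h = id"
proof
  have "h (real n powi 1 * 0 + 0) = real n powi 1 * h 0 + 0"
    using comm[OF affine_in_ideal_germs[OF n2 ideal_zero[OF n2], of 1]] by (rule comp_eq_dest)
  then have "h 0 = real n * h 0" by simp
  then have h0: "h 0 = 0" using n2 by simp
  have fixed: "h c = c" if c: "c \<in> nadic_ideal n" for c
  proof -
    have "h (real n powi 0 * 0 + c) = real n powi 0 * h 0 + c"
      using comm[OF affine_in_ideal_germs[OF n2 c, of 0]] by (rule comp_eq_dest)
    then show ?thesis by (simp add: h0)
  qed
  have dense: "\<exists>c\<in>nadic_ideal n. x < c \<and> c < y" if xy: "x < y" for x y
  proof -
    have "x / (real n - 1) < y / (real n - 1)" using xy n2 by (simp add: divide_strict_right_mono)
    then obtain z where z: "z \<in> n_adic n" "x / (real n - 1) < z" "z < y / (real n - 1)"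
      using n_adic_dense[OF n2] by blast
    then have "x < (real n - 1) * z" "(real n - 1) * z < y"
      using n2 by (auto simp: field_simps)
    then show ?thesis using z(1) unfolding nadic_ideal_def by blast
  qed
  fix x
  show "h x = id x"
  proof (rule ccontr)
    assume "h x \<noteq> id x"
    then consider "h x < x" | "x < h x" by fastforce
    then show False
    proof cases
      case 1
      then obtain c where "c \<in> nadic_ideal n" "h x < c" "c < x" using dense by blast
      then show False using fixed[of c] strict_mono_less[OF h, of c x] by simp
    next
      case 2
      then obtain c where "c \<in> nadic_ideal n" "x < c" "c < h x" using dense by blast
      then show False using fixed[of c] strict_mono_less[OF h, of x c] by simp
    qed
  qed
qed

context subdivision
begin

definition transport :: "(real \<Rightarrow> real) \<Rightarrow> real \<Rightarrow> real" where
  "transport g = \<Psi> \<circ> g \<circ> inverse_map \<Psi>"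

lemma inj_\<Psi>: "inj \<Psi>"
  using \<Psi>(1) by (rule strict_mono_imp_inj_on)

lemma transport_\<Psi>: "transport g (\<Psi> x) = \<Psi> (g x)"
  by (simp add: transport_def inv_f_f[OF inj_\<Psi>])

lemma transport_eqI: "(\<And>x. f (\<Psi> x) = \<Psi> (g x)) \<Longrightarrow> f = transport g"
proof
  fix y assume *: "\<And>x. f (\<Psi> x) = \<Psi> (g x)"
  obtain x where "y = \<Psi> x" using \<Psi>(2) by blast
  then show "f y = transport g y" using * transport_\<Psi> by simp
qed

lemma transport_comp: "transport g \<circ> transport h = transport (g \<circ> h)"
  by (rule transport_eqI) (simp add: transport_\<Psi>)

lemma transport_id: "transport id = id"
  by (rule transport_eqI[symmetric]) simp

lemma transport_inj: "transport g = transport h \<Longrightarrow> g = h"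
proof
  fix x assume "transport g = transport h"
  then have "\<Psi> (g x) = \<Psi> (h x)" by (simp flip: transport_\<Psi>)
  then show "g x = h x" using inj_\<Psi> by (simp add: inj_eq)
qed

lemma transport_mono: "strict_mono g \<Longrightarrow> strict_mono (transport g)"
  unfolding transport_def
  using \<Psi>(1) strict_mono_inv[OF \<Psi>(1,2)] by (simp add: strict_mono_def)

lemma transport_surj: "surj g \<Longrightarrow> surj (transport g)"
  unfolding transport_def
  by (intro comp_surj \<Psi>(2) inj_imp_surj_inv[OF inj_\<Psi>])

text \<open>For \<open>k = 0\<close> this is the group itself, and conjugation by the members for arbitrary \<open>k\<close> preserves it.\<close>

definition normalising :: "int \<Rightarrow> (real \<Rightarrow> real) set" where
  "normalising k = transport ` shifting k"

lemma normalising_strict_mono: "f \<in> normalising k \<Longrightarrow> strict_mono f"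
  unfolding normalising_def using shiftingD(1) transport_mono by blast

lemma normalising_surj: "f \<in> normalising k \<Longrightarrow> surj f"
  unfolding normalising_def using shiftingD(2) transport_surj by blast

lemma normalising_bij: "f \<in> normalising k \<Longrightarrow> bij f"
  unfolding bij_def using strict_mono_imp_inj_on[OF normalising_strict_mono] normalising_surj by blast

lemma normalising_inverse:
  assumes "f \<in> normalising k"
  shows "f (inverse_map f x) = x" "inverse_map f (f x) = x"
  using normalising_bij[OF assms] by (simp_all add: surj_f_inv_f bij_is_surj inv_f_f bij_is_inj)

lemma normalising_comp:
  assumes "f \<in> normalising k" "h \<in> normalising l" shows "h \<circ> f \<in> normalising (k + l)"
proof -
  obtain f' h' where "f' \<in> shifting k" "f = transport f'" "h' \<in> shifting l" "h = transport h'"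
    using assms unfolding normalising_def by blast
  then show ?thesis
    unfolding normalising_def using transport_comp[of h' f'] by (intro image_eqI[OF _ shifting_comp]) simp_all
qed

lemma normalising_inv:
  assumes "f \<in> normalising k" shows "inverse_map f \<in> normalising (- k)"
proof -
  obtain g where g: "g \<in> shifting k" "f = transport g" using assms by (auto simp: normalising_def)
  have "g \<circ> inverse_map g = id" "inverse_map g \<circ> g = id"
    using shiftingD(2)[OF g(1)] strict_mono_imp_inj_on[OF shiftingD(1)[OF g(1)]]
    by (blast intro: iffD1[OF surj_iff] iffD1[OF inj_iff])+
  then have "transport (inverse_map g) \<circ> f = id" "f \<circ> transport (inverse_map g) = id"
    unfolding g(2) transport_comp by (simp_all only: transport_id)
  then have "inverse_map f = transport (inverse_map g)"
    by (simp add: inv_unique_comp)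
  then show ?thesis using shifting_inv[OF g(1)] by (simp add: normalising_def)
qed

lemma normalising_disjoint: "f \<in> normalising k \<Longrightarrow> f \<in> normalising l \<Longrightarrow> M dvd k - l"
  unfolding normalising_def using shifting_disjoint transport_inj by blast

lemma ideal_germs_eq_normalising: "ideal_germs n = normalising 0"
proof (intro equalityI subsetI)
  fix f assume f: "f \<in> ideal_germs n"
  define g where "g = inverse_map \<Psi> \<circ> f \<circ> \<Psi>"
  have fg: "f (\<Psi> x) = \<Psi> (g x)" for x by (simp add: g_def surj_f_inv_f[OF \<Psi>(2)])
  have fm: "strict_mono f" "surj f" using f by (auto simp: ideal_germs_def)
  have "strict_mono g" "surj g"
    unfolding g_def using \<Psi>(1) strict_mono_inv[OF \<Psi>(1,2)] fm(1)
    by (simp add: strict_mono_def, intro comp_surj \<Psi>(2) fm(2) inj_imp_surj_inv[OF inj_\<Psi>])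
  then have "g \<in> shifting 0" by (rule ideal_germs_imp_shifting[where g = g, OF f fg])
  then show "f \<in> normalising 0" unfolding normalising_def using transport_eqI[where f = f and g = g, OF fg] by blast
next
  fix f assume "f \<in> normalising 0"
  then obtain g where g: "g \<in> shifting 0" "f = transport g" by (auto simp: normalising_def)
  then show "f \<in> ideal_germs n"
    using shifting_imp_ideal_germs[OF g(1) transport_\<Psi>] transport_mono transport_surj shiftingD by blast
qed

lemma B_group_simps:
  "carrier (B_group n) = normalising 0" "f \<otimes>\<^bsub>B_group n\<^esub> g = g \<circ> f" "\<one>\<^bsub>B_group n\<^esub> = id"
  using carrier_B_group[OF n_ge_2] ideal_germs_eq_normalising by (simp_all add: B_group_def A_group_def)

lemma group_B: "group (B_group n)"
proof (rule groupI; unfold B_group_simps)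
  have "id \<in> shifting 0" using dilate_power[of 0] by simp
  then show "id \<in> normalising 0" unfolding normalising_def using transport_id by (intro image_eqI) simp_all
  show "g \<circ> f \<in> normalising 0" if "f \<in> normalising 0" "g \<in> normalising 0" for f g using normalising_comp[OF that] by simp
  show "\<exists>g\<in>normalising 0. f \<circ> g = id" if f: "f \<in> normalising 0" for f
  proof
    show "inverse_map f \<in> normalising 0" using normalising_inv[OF f] by simp
    show "f \<circ> inverse_map f = id" by (rule ext) (simp add: normalising_inverse[OF f])
  qed
  show "h \<circ> (g \<circ> f) = h \<circ> g \<circ> f" for f g h :: "real \<Rightarrow> real" by (simp only: comp_assoc)
  show "f \<circ> id = f" for f :: "real \<Rightarrow> real" by simp
qed

lemma inv_B:
  assumes f: "f \<in> normalising 0" shows "inv\<^bsub>B_group n\<^esub> f = inverse_map f"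
proof (rule group.inv_equality[OF group_B]; unfold B_group_simps)
  show "f \<circ> inverse_map f = id" by (rule ext) (simp add: normalising_inverse[OF f])
  show "inverse_map f \<in> normalising 0" using normalising_inv[OF f] by simp
qed (rule f)

definition exotic :: "real \<Rightarrow> real" where "exotic = transport dilate"

lemma exotic_power: "exotic ^^ k \<in> normalising (int k)"
proof -
  have "exotic ^^ k = transport (dilate ^^ k)"
    by (induction k) (simp_all only: funpow.simps transport_id exotic_def transport_comp)
  then show ?thesis using dilate_power by (simp add: normalising_def)
qed

definition twist :: "(real \<Rightarrow> real) \<Rightarrow> (real \<Rightarrow> real) \<Rightarrow> real \<Rightarrow> real" where
  "twist h = (\<lambda>f\<in>normalising 0. h \<circ> f \<circ> inverse_map h)"

lemma twist_closed:
  assumes "h \<in> normalising k" "f \<in> normalising 0" shows "h \<circ> f \<circ> inverse_map h \<in> normalising 0"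
  using normalising_comp[OF normalising_comp[OF normalising_inv[OF assms(1)] assms(2)] assms(1)] by (simp add: comp_assoc)

lemma twist_auto:
  assumes h: "h \<in> normalising k" shows "twist h \<in> auto (B_group n)"
proof -
  have untwisted: "inverse_map h \<circ> f \<circ> h \<in> normalising 0" if "f \<in> normalising 0" for f
    using normalising_comp[OF normalising_comp[OF h that] normalising_inv[OF h]] by (simp add: comp_assoc)
  show ?thesis
  proof (rule autoI[where \<beta> = "\<lambda>f. inverse_map h \<circ> f \<circ> h"]; unfold B_group_simps)
    fix f assume f: "f \<in> normalising 0"
    show "twist h (inverse_map h \<circ> f \<circ> h) = f"
      using untwisted[OF f] by (simp add: twist_def fun_eq_iff normalising_inverse[OF h])
    show "inverse_map h \<circ> twist h f \<circ> h = f"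
      using f by (simp add: twist_def fun_eq_iff normalising_inverse[OF h])
    show "twist h f \<in> normalising 0" using f twist_closed[OF h] by (simp add: twist_def)
    show "inverse_map h \<circ> f \<circ> h \<in> normalising 0" using f by (rule untwisted)
  next
    fix f g assume fg: "f \<in> normalising 0" "g \<in> normalising 0"
    have "g \<circ> f \<in> normalising 0" using normalising_comp[OF fg] by simp
    then show "twist h (g \<circ> f) = twist h g \<circ> twist h f"
      using fg by (simp add: twist_def fun_eq_iff normalising_inverse[OF h])
  qed (simp add: twist_def)
qed

lemma twist_power: "twist exotic [^]\<^bsub>AutoGroup (B_group n)\<^esub> k = twist (exotic ^^ k)"
proof (induction k)
  case 0
  interpret A: group "AutoGroup (B_group n)" by (rule group.AutoGroup[OF group_B])
  show ?case by (simp add: AutoGroup_simps B_group_simps twist_def restrict_def fun_eq_iff)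
next
  case (Suc k)
  interpret A: group "AutoGroup (B_group n)" by (rule group.AutoGroup[OF group_B])
  have exotic: "exotic \<in> normalising 1" using exotic_power[of 1] by simp
  have inv: "inverse_map (exotic ^^ Suc k) = inverse_map exotic \<circ> inverse_map (exotic ^^ k)"
    using o_inv_distrib[OF normalising_bij[OF exotic_power[of k]] normalising_bij[OF exotic]]
    unfolding funpow_Suc_right .
  have "twist exotic [^]\<^bsub>AutoGroup (B_group n)\<^esub> Suc k = (\<lambda>f\<in>normalising 0. twist (exotic ^^ k) (twist exotic f))"
    using AutoGroup_simps(3)[OF twist_auto[OF exotic_power] twist_auto[OF exotic], of k]
    by (simp add: Suc B_group_simps)
  also have "\<dots> = twist (exotic ^^ Suc k)"
    unfolding twist_def
  proof (rule restrict_ext)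
    fix f assume f: "f \<in> normalising 0"
    show "(\<lambda>f\<in>normalising 0. exotic ^^ k \<circ> f \<circ> inverse_map (exotic ^^ k)) ((\<lambda>f\<in>normalising 0. exotic \<circ> f \<circ> inverse_map exotic) f) =
        exotic ^^ Suc k \<circ> f \<circ> inverse_map (exotic ^^ Suc k)"
      unfolding inv using f twist_closed[OF exotic f] by (simp add: funpow_Suc_right comp_assoc del: funpow.simps)
  qed
  finally show ?case .
qed

text \<open>If conjugation by \<open>h\<close> agrees on the group with conjugation by a member \<open>g\<close>, the quotient of \<open>h\<close> and \<open>g\<close> commutes
  with the whole group, so \<open>h = g\<close>. Then \<open>h\<close> shifts labels both by \<open>k\<close> and by \<open>0\<close>.\<close>

lemma twist_inner_iff:
  assumes h: "h \<in> normalising k"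
  shows "twist h \<in> Inn (B_group n) \<longleftrightarrow> M dvd k"
proof -
  interpret B: group "B_group n" by (rule group_B)
  have inner: "B.inner_aut g = twist g" if "g \<in> normalising 0" for g
    using that by (simp add: B.inner_aut_def twist_def B_group_simps inv_B comp_assoc)
  show ?thesis
  proof
    assume "twist h \<in> Inn (B_group n)"
    then obtain g where g: "g \<in> normalising 0" "twist h = twist g"
      by (auto simp: B.Inn_eq inner B_group_simps(1))
    note inv = normalising_inverse[OF h] normalising_inverse[OF g(1)]
    have "inverse_map g \<circ> h = id"
    proof (rule centraliser_trivial[OF n_ge_2])
      show "strict_mono (inverse_map g \<circ> h)" using normalising_strict_mono[OF normalising_comp[OF h normalising_inv[OF g(1)]]] .
      fix f assume "f \<in> ideal_germs n"
      then have "f \<in> normalising 0" by (simp add: ideal_germs_eq_normalising)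
      then have "h \<circ> f \<circ> inverse_map h = g \<circ> f \<circ> inverse_map g"
        using fun_cong[OF g(2), of f] by (simp add: twist_def)
      then have "h (f (inverse_map h (h x))) = g (f (inverse_map g (h x)))" for x
        by (metis comp_apply)
      then show "inverse_map g \<circ> h \<circ> f = f \<circ> (inverse_map g \<circ> h)"
        by (simp add: fun_eq_iff inv)
    qed
    then have "g (inverse_map g (h x)) = g x" for x by (metis comp_apply id_apply)
    then have "h = g" by (simp add: fun_eq_iff inv)
    then show "M dvd k" using normalising_disjoint[OF h] g(1) by fastforce
  next
    assume "M dvd k"
    then have "normalising k = normalising 0" using shifting_cong[of k 0] by (simp add: normalising_def)
    then show "twist h \<in> Inn (B_group n)"
      using h inner[of h] by (force simp: B.Inn_eq B_group_simps(1))
  qed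
qed

end

theorem theorem6p1p10:
  fixes n :: nat
  assumes "n \<ge> 4"
  shows "\<exists>x \<in> carrier (Out (B_group n)). group.ord (Out (B_group n)) x = n - 2"
proof -
  interpret subdivision n by unfold_locales (rule assms)
  have M: "M = int (n - 2)" using assms by (simp add: M_def of_nat_diff)
  have "twist exotic \<in> auto (B_group n)" using twist_auto[OF exotic_power[of 1]] by simp
  moreover have "twist exotic [^]\<^bsub>AutoGroup (B_group n)\<^esub> k \<in> Inn (B_group n) \<longleftrightarrow> n - 2 dvd k" for k
    unfolding twist_power using twist_inner_iff[OF exotic_power] by (simp only: M int_dvd_int_iff)
  ultimately show ?thesis by (rule group.ex_Out_of_order[OF group_B])
qed

end
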